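(* Let $(F,\delta)$ be a differential field of characteristic zero containing $x$ with $\delta(x)=1$, whose constant field $C_F$ is algebraically closed. Let $(F(t),\delta)$ be a monomial extension of $(F,\delta)$ whose constant field equals $C_F$. If $f\in F(t)$ is stable over the elementary extensions of $F(t)$, then there exists $g\in F(t)$ such that $f-\delta(g)$ is reduced.
   Context: A differential field is a field with an additive map $\delta$ satisfying the Leibniz rule. $(F(t),\delta)$ is a monomial extension of $(F,\delta)$ if $t$ is transcendental over $F$, the derivation extends that of $F$, and $\delta(t)\in F[t]$. A polynomial $p\in F[t]$ is special if $\gcd(p,\delta(p))=p$; a rational function in $F(t)$ is reduced if its denominator (in lowest terms) is special. For a differential extension $E\supseteq k$, $t\in E$ is elementary over $k$ if it is algebraic over $k$, or $t\neq0$ and $\delta(t)/t=\delta(a)$ for some $a\in k$, or $\delta(t)=\delta(a)/a$ for some $a\in k\setminus\{0\}$; $E$ is an elementary extension of $k$ if $E=k(t_1,\dots,t_n)$ with each $t_i$ elementary over $k(t_1,\dots,t_{i-1})$. An element $f$ of a differential field $K$ is stable over the elementary extensions of $K$ if there is a sequence $(g_i)_{i\in\mathbb{N}}$ such that each $g_i$ lies in some elementary extension of $K$ and $f=\delta^i(g_i)$ for all $i\in\mathbb{N}$. *)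

theory Defs
  imports "HOL-Computational_Algebra.Polynomial" "HOL-Computational_Algebra.Polynomial_Factorial"
    "HOL-Computational_Algebra.Fraction_Field"
begin

definition derivation :: "('a::comm_ring_1 \<Rightarrow> 'a) \<Rightarrow> bool" where
  "derivation D \<longleftrightarrow> (\<forall>x y. D (x + y) = D x + D y) \<and> (\<forall>x y. D (x * y) = D x * y + x * D y)"

definition constants :: "('a \<Rightarrow> 'a::comm_ring_1) \<Rightarrow> 'a set" where
  "constants D = {c. D c = 0}"

definition alg_closed_in :: "'a::field set \<Rightarrow> bool" where
  "alg_closed_in C \<longleftrightarrow> (\<forall>p::'a poly. (\<forall>i. coeff p i \<in> C) \<longrightarrow> degree p > 0 \<longrightarrow> (\<exists>c\<in>C. poly p c = 0))"

definition pemb :: "'a::field poly \<Rightarrow> 'a poly fract" where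
  "pemb p = Fract p 1"

definition cemb :: "'a::field \<Rightarrow> 'a poly fract" where
  "cemb a = pemb [:a:]"

definition tvar :: "'a::field poly fract" where
  "tvar = pemb [:0, 1:]"

(* (F(t), Dt) is a monomial extension of (F, D): Dt is a derivation of F(t) extending D
   with Dt(t) in F[t].  (t is transcendental over F by construction.) *)
definition monomial_ext :: "('a::field \<Rightarrow> 'a) \<Rightarrow> ('a poly fract \<Rightarrow> 'a poly fract) \<Rightarrow> bool" where
  "monomial_ext D Dt \<longleftrightarrow> derivation Dt \<and> (\<forall>a. Dt (cemb a) = cemb (D a))
      \<and> (\<exists>p. Dt tvar = pemb p)"

(* p in F[t] is special: gcd(p, delta p) = p.  Here delta p \<in> F[t] is q; since
   gcd is only defined up to units (and no gcd class instance exists for polynomials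
   over an arbitrary field), "gcd(p,q) = p up to a unit" is written as "p dvd q". *)
definition special :: "('a poly fract \<Rightarrow> 'a poly fract) \<Rightarrow> 'a::field poly \<Rightarrow> bool" where
  "special Dt p \<longleftrightarrow> (\<exists>q. Dt (pemb p) = pemb q \<and> p dvd q)"

definition reduced :: "('a poly fract \<Rightarrow> 'a poly fract) \<Rightarrow> 'a::field poly fract \<Rightarrow> bool" where
  "reduced Dt f \<longleftrightarrow> (\<exists>a b. b \<noteq> 0 \<and> coprime a b \<and> f = Fract a b \<and> special Dt b)"

definition subfield :: "'b::field set \<Rightarrow> bool" where
  "subfield L \<longleftrightarrow> 0 \<in> L \<and> 1 \<in> L \<and> (\<forall>x\<in>L. \<forall>y\<in>L. x + y \<in> L \<and> x * y \<in> L)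
     \<and> (\<forall>x\<in>L. - x \<in> L \<and> inverse x \<in> L)"

definition gen_field :: "'b::field set \<Rightarrow> 'b set" where
  "gen_field S = \<Inter> {L. subfield L \<and> S \<subseteq> L}"

definition elementary_over :: "('b::field \<Rightarrow> 'b) \<Rightarrow> 'b set \<Rightarrow> 'b \<Rightarrow> bool" where
  "elementary_over DE L t \<longleftrightarrow>
     (\<exists>p::'b poly. p \<noteq> 0 \<and> (\<forall>i. coeff p i \<in> L) \<and> poly p t = 0)
     \<or> (t \<noteq> 0 \<and> (\<exists>a\<in>L. DE t / t = DE a))
     \<or> (\<exists>a\<in>L. a \<noteq> 0 \<and> DE t = DE a / a)"

definition elementary_ext :: "('b::field \<Rightarrow> 'b) \<Rightarrow> 'b set \<Rightarrow> 'b set \<Rightarrow> bool" where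
  "elementary_ext DE K E \<longleftrightarrow> (\<exists>ts::'b list. E = gen_field (K \<union> set ts) \<and>
     (\<forall>i<length ts. elementary_over DE (gen_field (K \<union> set (take i ts))) (ts ! i)))"

definition diff_embedding :: "('a::field \<Rightarrow> 'a) \<Rightarrow> ('b::field \<Rightarrow> 'b) \<Rightarrow> ('a \<Rightarrow> 'b) \<Rightarrow> bool" where
  "diff_embedding DK DE \<iota> \<longleftrightarrow> (\<forall>x y. \<iota> (x + y) = \<iota> x + \<iota> y) \<and> (\<forall>x y. \<iota> (x * y) = \<iota> x * \<iota> y)
     \<and> \<iota> 1 = 1 \<and> (\<forall>x. DE (\<iota> x) = \<iota> (DK x))"

(* f \<in> K is stable over the elementary extensions of (K, DK): for each i there is a
   differential field extension of K (realized on the ambient type 'b via an embedding),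
   an elementary extension E of K inside it, and g_i \<in> E with f = delta^i (g_i). *)
definition stable_elem :: "('a::field \<Rightarrow> 'a) \<Rightarrow> 'a \<Rightarrow> 'b::field itself \<Rightarrow> bool" where
  "stable_elem DK f _ \<longleftrightarrow> (\<exists>g::nat \<Rightarrow> 'b. \<forall>i. \<exists>(DE::'b \<Rightarrow> 'b) \<iota> E.
     derivation DE \<and> diff_embedding DK DE \<iota> \<and> elementary_ext DE (range \<iota>) E
     \<and> g i \<in> E \<and> \<iota> f = (DE ^^ i) (g i))"

end

theory Submission
  imports Defs "Jordan_Normal_Form.Determinant"
begin

text \<open>
  Integrating by parts, stability of \<open>f\<close> makes every \<open>x\<^sup>j f\<close> elementary integrable, so by
  Liouville's theorem \<open>x\<^sup>j f\<close> is a derivative plus a combination of logarithmic derivatives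
  with constant coefficients, over \<open>F(C)(t)\<close> where \<open>C\<close> is the field of all constants of the ambient
  field.  Hence at every normal prime \<open>p\<close> the residue \<open>c\<^sub>j\<close> of \<open>x\<^sup>j f\<close> is constant.  Write
  \<open>f = \<delta>(g) + s\<close> with \<open>s\<close> having at most a simple pole at \<open>p\<close>.  The residue of \<open>g\<close> is
  \<open>x c\<^sub>0 - c\<^sub>1\<close>, an antiderivative of \<open>c\<^sub>0\<close>, and \<open>g\<close> has smaller pole order than
  \<open>f\<close>; iterating, \<open>c\<^sub>0\<close> is an iterated derivative of the residue of an element
  without pole, so \<open>c\<^sub>0 = 0\<close>.  Thus \<open>s\<close> has no pole at \<open>p\<close>, and a representative of
  \<open>f\<close> modulo derivatives with denominator of minimal degree is reduced.

  New constants are handled by putting all of \<open>C\<close> into the base field from the start: \<open>t\<close> stays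
  transcendental over \<open>F(C)\<close> because \<open>C\<close> and \<open>F(t)\<close> are linearly disjoint over the constants
  of \<open>F(t)\<close>.
\<close>

section \<open>Polynomials over a subfield\<close>

text \<open>All fields are subsets of the one ambient type \<open>'b\<close>, because stability
  supplies a separate derivation, embedding and tower on \<open>'b\<close> for each index. The
  constants adjoined depend on that derivation, so the prime over F(C) at which residues are taken
  is known only after the index is fixed. The index is therefore read off the denominator of f,
  whose degree bounds the pole order at every such prime; that single index suffices. A pole need
  not be rational over the base, but no splitting field is needed: a residue of h at p is an element
  c of the coefficient field for which h - c \<delta>(p)/p is a derivative plus an element without
  pole at p. For a logarithmic derivative this c is an integer, which is why Liouville's theorem
  yields constant residues. The descent in Liouville's theorem breaks down if a new generator brings
  new constants; with C in the base, a new constant is a contradiction. The algebraic steps use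
  trace and norm of the regular representation, so no conjugates or normal closure occur.\<close>

lemma subfieldD:
  assumes "subfield L"
  shows subfield_0: "0 \<in> L" and subfield_1: "1 \<in> L"
    and subfield_add: "a \<in> L \<Longrightarrow> b \<in> L \<Longrightarrow> a + b \<in> L"
    and subfield_mult: "a \<in> L \<Longrightarrow> b \<in> L \<Longrightarrow> a * b \<in> L"
    and subfield_uminus: "a \<in> L \<Longrightarrow> - a \<in> L"
    and subfield_inverse: "a \<in> L \<Longrightarrow> inverse a \<in> L"
  using assms by (auto simp: subfield_def)

lemma subfield_diff: "subfield L \<Longrightarrow> a \<in> L \<Longrightarrow> b \<in> L \<Longrightarrow> a - b \<in> L"
  using subfield_add[of L a "- b"] subfield_uminus[of L b] by simp

lemma subfield_divide: "subfield L \<Longrightarrow> a \<in> L \<Longrightarrow> b \<in> L \<Longrightarrow> a / b \<in> L"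
  by (simp add: divide_inverse subfield_mult subfield_inverse)

lemma subfield_of_nat: "subfield L \<Longrightarrow> of_nat n \<in> L"
  by (induction n) (auto intro: subfield_0 subfield_add subfield_1)

lemma subfield_power: "subfield L \<Longrightarrow> a \<in> L \<Longrightarrow> a ^ n \<in> L"
  by (induction n) (auto intro: subfield_1 subfield_mult)

lemma subfield_sum: "subfield L \<Longrightarrow> (\<And>i. i \<in> I \<Longrightarrow> f i \<in> L) \<Longrightarrow> sum f I \<in> L"
  by (induction I rule: infinite_finite_induct) (auto intro: subfield_0 subfield_add)

lemma subfield_prod: "subfield L \<Longrightarrow> (\<And>i. i \<in> I \<Longrightarrow> f i \<in> L) \<Longrightarrow> prod f I \<in> L"
  by (induction I rule: infinite_finite_induct) (auto intro: subfield_1 subfield_mult)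

lemmas subfield_intros = subfield_0 subfield_1 subfield_add subfield_mult subfield_uminus
  subfield_diff subfield_divide subfield_of_nat subfield_power subfield_sum subfield_prod

lemma subfield_UNIV: "subfield UNIV"
  by (simp add: subfield_def)

lemma subfield_gen_field: "subfield (gen_field S)"
  unfolding gen_field_def subfield_def by blast

lemma gen_field_superset: "S \<subseteq> gen_field S"
  unfolding gen_field_def by blast

lemma gen_field_least: "subfield L \<Longrightarrow> S \<subseteq> L \<Longrightarrow> gen_field S \<subseteq> L"
  unfolding gen_field_def by blast

text \<open>L[X] is kept inside the polynomial ring of the ambient field, so that
  \<open>dvd\<close>, \<open>div\<close> and \<open>mod\<close> are those of the ambient ring and
  the same polynomial can be viewed over several subfields.\<close>

definition polys_over :: "'b::field set \<Rightarrow> 'b poly set" where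
  "polys_over L = {p. \<forall>i. coeff p i \<in> L}"

lemma polys_over_coeff: "p \<in> polys_over L \<Longrightarrow> coeff p i \<in> L"
  by (simp add: polys_over_def)

lemma polys_over_UNIV: "polys_over UNIV = UNIV"
  by (simp add: polys_over_def)

lemma polys_over_mono: "L \<subseteq> M \<Longrightarrow> polys_over L \<subseteq> polys_over M"
  by (auto simp: polys_over_def)

text \<open>Only divisors with coefficients in L count, since P may split over the ambient
  field.\<close>

definition irreducible_over :: "'b::field set \<Rightarrow> 'b poly \<Rightarrow> bool" where
  "irreducible_over L P \<longleftrightarrow> P \<in> polys_over L \<and> degree P > 0 \<and>
    (\<forall>Q\<in>polys_over L. Q dvd P \<longrightarrow> degree Q = 0 \<or> degree Q = degree P)"

context
  fixes L :: "'b::field set"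
  assumes L: "subfield L"
begin

lemma polys_over_0: "0 \<in> polys_over L"
  by (simp add: polys_over_def subfield_0[OF L])

lemma polys_over_add: "p \<in> polys_over L \<Longrightarrow> q \<in> polys_over L \<Longrightarrow> p + q \<in> polys_over L"
  by (simp add: polys_over_def subfield_add[OF L])

lemma polys_over_diff: "p \<in> polys_over L \<Longrightarrow> q \<in> polys_over L \<Longrightarrow> p - q \<in> polys_over L"
  by (simp add: polys_over_def subfield_diff[OF L])

lemma polys_over_uminus: "p \<in> polys_over L \<Longrightarrow> - p \<in> polys_over L"
  by (simp add: polys_over_def subfield_uminus[OF L])

lemma polys_over_mult: "p \<in> polys_over L \<Longrightarrow> q \<in> polys_over L \<Longrightarrow> p * q \<in> polys_over L"
  by (auto simp: polys_over_def coeff_mult intro!: subfield_sum[OF L] subfield_mult[OF L])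

lemma polys_over_smult: "c \<in> L \<Longrightarrow> p \<in> polys_over L \<Longrightarrow> Polynomial.smult c p \<in> polys_over L"
  by (simp add: polys_over_def subfield_mult[OF L])

lemma polys_over_pCons: "c \<in> L \<Longrightarrow> p \<in> polys_over L \<Longrightarrow> pCons c p \<in> polys_over L"
  by (simp add: polys_over_def coeff_pCons split: nat.split)

lemma polys_over_1: "1 \<in> polys_over L"
  by (simp add: polys_over_0 polys_over_pCons subfield_1[OF L] one_pCons)

lemma polys_over_power: "p \<in> polys_over L \<Longrightarrow> p ^ n \<in> polys_over L"
  by (induction n) (simp_all add: polys_over_1 polys_over_mult)

lemma polys_over_monom: "c \<in> L \<Longrightarrow> monom c n \<in> polys_over L"
  by (simp add: polys_over_def subfield_0[OF L])

lemma polys_over_pderiv: "p \<in> polys_over L \<Longrightarrow> pderiv p \<in> polys_over L"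
  by (simp add: polys_over_def coeff_pderiv subfield_mult[OF L] subfield_of_nat[OF L]
      subfield_add[OF L] subfield_1[OF L])

lemma polys_over_map_poly:
  "p \<in> polys_over L \<Longrightarrow> h 0 = 0 \<Longrightarrow> (\<And>a. a \<in> L \<Longrightarrow> h a \<in> L) \<Longrightarrow> map_poly h p \<in> polys_over L"
  by (simp add: polys_over_def coeff_map_poly)

lemma polys_over_pdivmod_ex:
  assumes B: "B \<in> polys_over L" "B \<noteq> 0" and A: "A \<in> polys_over L"
  shows "\<exists>Q\<in>polys_over L. \<exists>R\<in>polys_over L. A = B * Q + R \<and> (R = 0 \<or> degree R < degree B)"
  using A
proof (induction "degree A" arbitrary: A rule: less_induct)
  case less
  show ?case
  proof (cases "A = 0 \<or> degree A < degree B")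
    case True
    then show ?thesis using less.prems polys_over_0 by (intro bexI[of _ 0] bexI[of _ A]) auto
  next
    case False
    define S where "S = monom (lead_coeff A / lead_coeff B) (degree A - degree B)"
    have S: "S \<in> polys_over L"
      unfolding S_def using B less.prems
      by (intro polys_over_monom subfield_divide[OF L] polys_over_coeff)
    define A' where "A' = A - B * S"
    have A': "A' \<in> polys_over L"
      unfolding A'_def by (intro polys_over_diff polys_over_mult less.prems B S)
    have "degree (B * S) \<le> degree B + (degree A - degree B)"
      unfolding S_def by (intro order.trans[OF degree_mult_le] add_left_mono degree_monom_le)
    then have degS: "degree (B * S) \<le> degree A" using False by simp
    have "coeff (B * S) (degree A) = lead_coeff A"
      using False B by (subst mult.commute) (simp add: S_def coeff_monom_mult)
    then have c0: "coeff A' (degree A) = 0" by (simp add: A'_def)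
    have le: "degree A' \<le> degree A"
      unfolding A'_def using degS by (intro degree_diff_le) auto
    show ?thesis
    proof (cases "A' = 0")
      case True
      then show ?thesis using S polys_over_0
        by (intro bexI[of _ S] bexI[of _ 0]) (auto simp: A'_def)
    next
      case False
      then have "degree A' < degree A"
        using c0 le by (metis leading_coeff_0_iff le_neq_implies_less)
      from less.hyps[OF this A'] obtain Q R where "Q \<in> polys_over L" "R \<in> polys_over L"
        "A' = B * Q + R" "R = 0 \<or> degree R < degree B" by blast
      then show ?thesis using S
        by (intro bexI[of _ "Q + S"] bexI[of _ R])
          (auto simp: A'_def algebra_simps intro: polys_over_add)
    qed
  qed
qed

text \<open>Long division by B needs only field operations on coefficients, hence stays in L; by
  uniqueness its result is the ambient quotient and remainder. Divisibility over L and over the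
  ambient field therefore agree.\<close>

lemma polys_over_div_mod:
  assumes B: "B \<in> polys_over L" and A: "A \<in> polys_over L"
  shows polys_over_div: "A div B \<in> polys_over L" and polys_over_mod: "A mod B \<in> polys_over L"
proof -
  have "A div B \<in> polys_over L \<and> A mod B \<in> polys_over L"
  proof (cases "B = 0")
    case False
    from polys_over_pdivmod_ex[OF B False A] obtain Q R where QR: "Q \<in> polys_over L"
      "R \<in> polys_over L" "A = B * Q + R" "R = 0 \<or> degree R < degree B" by blast
    have "(A div B, A mod B) = (Q, R)"
    proof (rule euclidean_relation_polyI)
      assume "B dvd A"
      then have "B dvd R" using QR(3) by (simp add: dvd_add_right_iff)
      then have "R = 0"
        using QR(4) dvd_imp_degree_le[of B R] by linarith
      then show "R = 0 \<and> A = Q * B"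
        using QR(3) by (simp add: mult.commute)
    qed (use False QR in \<open>auto simp: mult.commute\<close>)
    then show ?thesis using QR by simp
  qed (use A polys_over_0 in auto)
  then show "A div B \<in> polys_over L" "A mod B \<in> polys_over L" by auto
qed

lemma polys_over_dvdE:
  assumes "P \<in> polys_over L" "A \<in> polys_over L" "P dvd A"
  obtains Q where "Q \<in> polys_over L" "A = P * Q"
  using assms polys_over_div by (metis dvd_mult_div_cancel)

text \<open>An element of least degree divides all others, because the remainder is again in I. The
  closure condition is just what this argument and its two uses, Bezout relations and minimal
  polynomials, require.\<close>

lemma polys_over_principal:
  assumes sub: "I \<subseteq> polys_over L" and ex: "A0 \<in> I" "A0 \<noteq> 0"
    and cl: "\<And>A B Q. A \<in> I \<Longrightarrow> B \<in> I \<Longrightarrow> Q \<in> polys_over L \<Longrightarrow> A - B * Q \<in> I"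
  shows "\<exists>G\<in>I. G \<noteq> 0 \<and> (\<forall>A\<in>I. G dvd A \<and> (A \<noteq> 0 \<longrightarrow> degree G \<le> degree A))"
proof -
  define G where "G = (ARG_MIN degree A. A \<in> I \<and> A \<noteq> 0)"
  have G: "G \<in> I" "G \<noteq> 0" and min: "\<And>A. A \<in> I \<Longrightarrow> A \<noteq> 0 \<Longrightarrow> degree G \<le> degree A"
    using arg_min_nat_lemma[of "\<lambda>A. A \<in> I \<and> A \<noteq> 0" A0 degree] ex unfolding G_def by auto
  have "G dvd A" if A: "A \<in> I" for A
  proof -
    have "A mod G = A - G * (A div G)"
      by (simp add: minus_mult_div_eq_mod)
    also have "\<dots> \<in> I" using A G sub by (intro cl polys_over_div) auto
    finally have "A mod G \<in> I" .
    then have "A mod G = 0"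
      using min[of "A mod G"] degree_mod_less[OF G(2), of A] by linarith
    then show ?thesis by (simp add: mod_eq_0_iff_dvd)
  qed
  then show ?thesis using G min by blast
qed

lemma polys_over_bezout:
  assumes A: "A \<in> polys_over L" "A \<noteq> 0" and B: "B \<in> polys_over L"
  obtains U V where "U \<in> polys_over L" "V \<in> polys_over L"
    "U * A + V * B \<noteq> 0" "U * A + V * B dvd A" "U * A + V * B dvd B"
proof -
  define I where "I = {U * A + V * B |U V. U \<in> polys_over L \<and> V \<in> polys_over L}"
  have AI: "A \<in> I" unfolding I_def
    by (rule CollectI, rule exI[of _ 1], rule exI[of _ 0]) (simp add: polys_over_0 polys_over_1)
  have BI: "B \<in> I" unfolding I_def
    by (rule CollectI, rule exI[of _ 0], rule exI[of _ 1]) (simp add: polys_over_0 polys_over_1)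
  have sub: "I \<subseteq> polys_over L"
    unfolding I_def using A B by (auto intro!: polys_over_add polys_over_mult)
  have cl: "X - Y * Q \<in> I" if "X \<in> I" "Y \<in> I" "Q \<in> polys_over L" for X Y Q
  proof -
    from that obtain U V U' V' where "X = U * A + V * B" "Y = U' * A + V' * B"
      "U \<in> polys_over L" "V \<in> polys_over L" "U' \<in> polys_over L" "V' \<in> polys_over L"
      unfolding I_def by blast
    moreover from this have "X - Y * Q = (U - U' * Q) * A + (V - V' * Q) * B"
      by (simp add: algebra_simps)
    ultimately show ?thesis using that(3) unfolding I_def
      by (auto intro!: polys_over_diff polys_over_mult)
  qed
  obtain G where "G \<in> I" "G \<noteq> 0" "\<forall>A\<in>I. G dvd A"
    using polys_over_principal[OF sub AI A(2) cl] by blast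
  then show thesis using AI BI that unfolding I_def by blast
qed

lemma irreducible_over_ex:
  assumes "A \<in> polys_over L" "degree A > 0"
  obtains P where "irreducible_over L P" "P dvd A"
proof -
  define G where "G = (ARG_MIN degree P. P \<in> polys_over L \<and> P dvd A \<and> degree P > 0)"
  have G: "G \<in> polys_over L" "G dvd A" "degree G > 0"
    and min: "\<And>P. P \<in> polys_over L \<Longrightarrow> P dvd A \<Longrightarrow> degree P > 0 \<Longrightarrow> degree G \<le> degree P"
    using arg_min_nat_lemma[of "\<lambda>P. P \<in> polys_over L \<and> P dvd A \<and> degree P > 0" A degree] assms
    unfolding G_def by auto
  have "degree Q = 0 \<or> degree Q = degree G" if "Q \<in> polys_over L" "Q dvd G" for Q
  proof -
    have "G \<noteq> 0" "Q dvd A" using G that dvd_trans by auto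
    then show ?thesis using min[OF that(1)] dvd_imp_degree_le[OF that(2)] by linarith
  qed
  then show thesis using G that unfolding irreducible_over_def by blast
qed

text \<open>The gcd has degree 0 or that of P by irreducibility; in the second case it is an
  associate of P, which would then divide A.\<close>

lemma irreducible_over_bezout:
  assumes P: "irreducible_over L P" and A: "A \<in> polys_over L" "\<not> P dvd A"
  obtains U V where "U \<in> polys_over L" "V \<in> polys_over L" "U * P + V * A = 1"
proof -
  have P': "P \<in> polys_over L" "P \<noteq> 0" using P by (auto simp: irreducible_over_def)
  from polys_over_bezout[OF P' A(1)] obtain U V where UV: "U \<in> polys_over L" "V \<in> polys_over L"
    and G: "U * P + V * A \<noteq> 0" "U * P + V * A dvd P" "U * P + V * A dvd A" by blast
  define G where "G = U * P + V * A"
  have GL: "G \<in> polys_over L" unfolding G_def using UV P' A by (intro polys_over_add polys_over_mult)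
  have "degree G \<noteq> degree P"
  proof
    assume deg: "degree G = degree P"
    from G obtain Q where Q: "P = G * Q" unfolding G_def by auto
    then have "degree Q = 0" using deg P' by (auto simp: degree_mult_eq)
    then obtain c where "Q = [:c:]" by (rule degree_eq_zeroE)
    then have "P dvd G" using Q P' by (simp add: smult_dvd_iff)
    then show False using A(2) G dvd_trans unfolding G_def by blast
  qed
  then have "degree G = 0" using P GL G unfolding irreducible_over_def G_def by blast
  then obtain c where c: "G = [:c:]" by (rule degree_eq_zeroE)
  then have c0: "c \<noteq> 0" using G unfolding G_def by auto
  have "c \<in> L" using polys_over_coeff[OF GL, of 0] c by simp
  then have "inverse c \<in> L" by (rule subfield_inverse[OF L])
  moreover have "Polynomial.smult (inverse c) U * P + Polynomial.smult (inverse c) V * A = Polynomial.smult (inverse c) G"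
    by (simp add: G_def smult_add_right)
  ultimately show thesis using c c0 UV that[of "Polynomial.smult (inverse c) U" "Polynomial.smult (inverse c) V"]
    by (simp add: polys_over_smult one_pCons)
qed

text \<open>Multiplying the Bezout relation of P and A by B proves it, so B may have coefficients
  outside L.\<close>

lemma irreducible_over_prime:
  assumes P: "irreducible_over L P" and A: "A \<in> polys_over L" and dvd: "P dvd A * B"
  shows "P dvd A \<or> P dvd B"
proof (rule ccontr)
  assume *: "\<not> (P dvd A \<or> P dvd B)"
  then obtain U V where UV: "U * P + V * A = 1" using irreducible_over_bezout[OF P A] by blast
  have "B = (U * P + V * A) * B" by (simp add: UV)
  also have "\<dots> = P * (U * B) + A * B * V" by (simp add: algebra_simps)
  also have "P dvd \<dots>" using dvd by simp
  finally show False using * by simp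
qed

lemma irreducible_over_not_dvd_power:
  assumes P: "irreducible_over L P" and A: "A \<in> polys_over L" "\<not> P dvd A"
  shows "\<not> P dvd A ^ n"
proof (induction n)
  case 0
  have "degree P > 0" "P \<noteq> 0" using P by (auto simp: irreducible_over_def)
  then show ?case using is_unit_iff_degree[of P] by simp
next
  case (Suc n)
  then show ?case unfolding power_Suc using irreducible_over_prime[OF P A(1)] A(2) by blast
qed

lemma polys_over_multiplicity:
  assumes P: "P \<in> polys_over L" "degree P > 0" and A: "A \<in> polys_over L" "A \<noteq> 0"
  obtains n Q where "A = P ^ n * Q" "Q \<in> polys_over L" "\<not> P dvd Q"
proof -
  have "\<exists>n Q. A = P ^ n * Q \<and> Q \<in> polys_over L \<and> \<not> P dvd Q"
    using A
  proof (induction "degree A" arbitrary: A rule: less_induct)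
    case less
    show ?case
    proof (cases "P dvd A")
      case True
      then obtain Q where Q: "Q \<in> polys_over L" "A = P * Q"
        using polys_over_dvdE P less.prems by metis
      then have "degree Q < degree A" using P less.prems by (auto simp: degree_mult_eq)
      moreover have "Q \<noteq> 0" using Q less.prems by auto
      ultimately obtain n R where "Q = P ^ n * R" "R \<in> polys_over L" "\<not> P dvd R"
        using less.hyps[of Q] Q by blast
      then show ?thesis using Q by (intro exI[of _ "Suc n"] exI[of _ R]) simp
    next
      case False
      then show ?thesis using less.prems by (intro exI[of _ 0] exI[of _ A]) simp
    qed
  qed
  then show thesis using that by blast
qed

end

section \<open>Liouville forms and transcendental extensions\<close>

context
  fixes d :: "'b::comm_ring_1 \<Rightarrow> 'b"
  assumes d: "derivation d"
begin

lemma derivation_add: "d (a + b) = d a + d b"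
  using d by (simp add: derivation_def)

lemma derivation_mult: "d (a * b) = d a * b + a * d b"
  using d by (simp add: derivation_def)

lemma derivation_0: "d 0 = 0"
  using derivation_add[of 0 0] by simp

lemma derivation_1: "d 1 = 0"
  using derivation_mult[of 1 1] by simp

lemma derivation_uminus: "d (- a) = - d a"
  using derivation_add[of a "- a"] by (simp add: derivation_0 add_eq_0_iff)

lemma derivation_diff: "d (a - b) = d a - d b"
  using derivation_add[of a "- b"] by (simp add: derivation_uminus)

lemma derivation_of_nat: "d (of_nat n) = 0"
  by (induction n) (simp_all add: derivation_0 derivation_1 derivation_add)

lemma derivation_sum: "d (sum f I) = (\<Sum>i\<in>I. d (f i))"
  by (induction I rule: infinite_finite_induct) (simp_all add: derivation_0 derivation_add)

lemma derivation_power_Suc: "d (a ^ Suc n) = of_nat (Suc n) * a ^ n * d a"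
  by (induction n) (simp_all add: derivation_mult algebra_simps)

lemma map_poly_derivation_mult: "map_poly d (A * B) = map_poly d A * B + A * map_poly d B"
  by (rule poly_eqI)
    (simp add: coeff_map_poly derivation_0 coeff_mult derivation_sum derivation_mult sum.distrib)

lemma constants_0: "0 \<in> constants d"
  and constants_1: "1 \<in> constants d"
  and constants_of_nat: "of_nat n \<in> constants d"
  and constants_add: "a \<in> constants d \<Longrightarrow> b \<in> constants d \<Longrightarrow> a + b \<in> constants d"
  and constants_diff: "a \<in> constants d \<Longrightarrow> b \<in> constants d \<Longrightarrow> a - b \<in> constants d"
  and constants_uminus: "a \<in> constants d \<Longrightarrow> - a \<in> constants d"
  and constants_mult: "a \<in> constants d \<Longrightarrow> b \<in> constants d \<Longrightarrow> a * b \<in> constants d"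
  by (simp_all add: constants_def derivation_0 derivation_1 derivation_of_nat derivation_add
      derivation_diff derivation_uminus derivation_mult)

lemma derivation_cmult: "c \<in> constants d \<Longrightarrow> d (c * a) = c * d a"
  by (simp add: constants_def derivation_mult)

end

lemma derivation_poly:
  fixes d :: "'b::idom \<Rightarrow> 'b"
  assumes "derivation d"
  shows "d (poly A t) = poly (map_poly d A) t + poly (pderiv A) t * d t"
  by (induction A)
    (simp_all add: assms derivation_0 derivation_add derivation_mult pderiv_pCons map_poly_pCons
      algebra_simps)

lemma derivation_divide:
  fixes d :: "'b::field \<Rightarrow> 'b"
  assumes "derivation d"
  shows "d (a / b) = (d a * b - a * d b) / b ^ 2"
proof (cases "b = 0")
  case False
  have "d a = d (a / b * b)" using False by simp
  also have "\<dots> = d (a / b) * b + a / b * d b" by (rule derivation_mult[OF assms])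
  finally show ?thesis using False by (simp add: field_simps power2_eq_square)
qed (simp add: derivation_0[OF assms])

lemma constants_divide:
  fixes d :: "'b::field \<Rightarrow> 'b"
  assumes "derivation d" "a \<in> constants d" "b \<in> constants d"
  shows "a / b \<in> constants d"
  using assms by (simp add: constants_def derivation_divide)

lemma logderiv_divide:
  fixes d :: "'b::field \<Rightarrow> 'b"
  assumes "derivation d" "a \<noteq> 0" "b \<noteq> 0"
  shows "d (a / b) / (a / b) = d a / a - d b / b"
  using assms by (simp add: derivation_divide field_simps power2_eq_square)

lemma logderiv_mult:
  fixes d :: "'b::field \<Rightarrow> 'b"
  assumes "derivation d" "a \<noteq> 0" "b \<noteq> 0"
  shows "d (a * b) / (a * b) = d a / a + d b / b"
  using assms by (simp add: derivation_mult field_simps)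

text \<open>The derivation of the polynomial ring that acts as d on coefficients and sends the
  variable to W. When d t is W(t), evaluation at t intertwines it with d.\<close>

definition pder :: "('b::idom \<Rightarrow> 'b) \<Rightarrow> 'b poly \<Rightarrow> 'b poly \<Rightarrow> 'b poly" where
  "pder d W A = map_poly d A + W * pderiv A"

lemma pder_mult: "derivation d \<Longrightarrow> pder d W (A * B) = pder d W A * B + A * pder d W B"
  by (simp add: pder_def map_poly_derivation_mult pderiv_mult algebra_simps)

lemma derivation_poly_pder:
  "derivation d \<Longrightarrow> d t = poly W t \<Longrightarrow> d (poly A t) = poly (pder d W A) t"
  by (simp add: derivation_poly pder_def mult.commute)

lemma polys_over_pder:
  assumes "subfield L" "derivation d" "\<And>a. a \<in> L \<Longrightarrow> d a \<in> L" "W \<in> polys_over L" "A \<in> polys_over L"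
  shows "pder d W A \<in> polys_over L"
  unfolding pder_def using assms
  by (intro polys_over_add polys_over_mult polys_over_pderiv polys_over_map_poly derivation_0)

text \<open>The field L(t), for t transcendental or algebraic over L.\<close>

definition fracs :: "'b::field set \<Rightarrow> 'b \<Rightarrow> 'b set" where
  "fracs L t = {poly A t / poly B t |A B. A \<in> polys_over L \<and> B \<in> polys_over L \<and> poly B t \<noteq> 0}"

lemma fracsI: "A \<in> polys_over L \<Longrightarrow> B \<in> polys_over L \<Longrightarrow> poly B t \<noteq> 0 \<Longrightarrow>
    h = poly A t / poly B t \<Longrightarrow> h \<in> fracs L t"
  unfolding fracs_def by blast

lemma fracsE:
  assumes "h \<in> fracs L t"
  obtains A B where "A \<in> polys_over L" "B \<in> polys_over L" "poly B t \<noteq> 0" "h = poly A t / poly B t"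
  using assms unfolding fracs_def by blast

context
  fixes L :: "'b::field set"
  assumes L: "subfield L"
begin

lemma fracs_poly: "A \<in> polys_over L \<Longrightarrow> poly A t \<in> fracs L t"
  by (rule fracsI[of A _ 1]) (auto simp: polys_over_1[OF L])

lemma fracs_superset: "L \<subseteq> fracs L t"
proof
  fix a assume "a \<in> L"
  then have "[:a:] \<in> polys_over L" by (simp add: L polys_over_0 polys_over_pCons)
  from fracs_poly[OF this, of t] show "a \<in> fracs L t" by simp
qed

lemma fracs_generator: "t \<in> fracs L t"
proof -
  have "[:0, 1:] \<in> polys_over L"
    by (simp add: L polys_over_0 polys_over_pCons subfield_0 subfield_1)
  from fracs_poly[OF this, of t] show ?thesis by simp
qed

lemma subfield_fracs: "subfield (fracs L t)"
proof -
  have ring: "a + b \<in> fracs L t \<and> a * b \<in> fracs L t" if ab: "a \<in> fracs L t" "b \<in> fracs L t" for a b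
  proof -
    from ab(1) obtain A B where AB: "A \<in> polys_over L" "B \<in> polys_over L" "poly B t \<noteq> 0"
      "a = poly A t / poly B t" by (rule fracsE)
    from ab(2) obtain A' B' where AB': "A' \<in> polys_over L" "B' \<in> polys_over L" "poly B' t \<noteq> 0"
      "b = poly A' t / poly B' t" by (rule fracsE)
    have BB: "B * B' \<in> polys_over L" by (intro polys_over_mult[OF L] AB AB')
    have "A * B' + A' * B \<in> polys_over L"
      by (intro polys_over_mult[OF L] polys_over_add[OF L] AB AB')
    then have "a + b \<in> fracs L t"
      by (rule fracsI[OF _ BB]) (use AB AB' in \<open>simp_all add: add_frac_eq\<close>)
    moreover have "A * A' \<in> polys_over L" by (intro polys_over_mult[OF L] AB AB')
    then have "a * b \<in> fracs L t"
      by (rule fracsI[OF _ BB]) (use AB AB' in simp_all)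
    ultimately show ?thesis by blast
  qed
  have neg: "- a \<in> fracs L t \<and> inverse a \<in> fracs L t" if a: "a \<in> fracs L t" for a
  proof -
    from a obtain A B where AB: "A \<in> polys_over L" "B \<in> polys_over L" "poly B t \<noteq> 0"
      "a = poly A t / poly B t" by (rule fracsE)
    have "- a \<in> fracs L t"
      by (rule fracsI[OF polys_over_uminus[OF L AB(1)] AB(2)]) (use AB in simp_all)
    moreover have "inverse a \<in> fracs L t"
    proof (cases "a = 0")
      case False
      show ?thesis by (rule fracsI[OF AB(2,1)]) (use AB False in simp_all)
    qed (use fracs_superset subfield_0[OF L] in auto)
    ultimately show ?thesis by blast
  qed
  show ?thesis unfolding subfield_def
    using ring neg fracs_superset subfield_0[OF L] subfield_1[OF L] by blast
qed

lemma fracs_closed: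
  assumes d: "derivation d" and Ld: "\<And>a. a \<in> L \<Longrightarrow> d a \<in> L" and dt: "d t \<in> fracs L t"
    and h: "h \<in> fracs L t"
  shows "d h \<in> fracs L t"
proof -
  note sf = subfield_fracs[of t]
  have pol: "d (poly A t) \<in> fracs L t" if A: "A \<in> polys_over L" for A
    unfolding derivation_poly[OF d] using A dt
    by (intro subfield_add[OF sf] subfield_mult[OF sf] fracs_poly polys_over_map_poly[OF L]
        polys_over_pderiv[OF L] derivation_0[OF d] Ld)
  from h obtain A B where AB: "A \<in> polys_over L" "B \<in> polys_over L" "poly B t \<noteq> 0"
      "h = poly A t / poly B t" by (rule fracsE)
  show ?thesis unfolding AB(4) derivation_divide[OF d]
    by (intro subfield_divide[OF sf] subfield_diff[OF sf] subfield_mult[OF sf]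
      subfield_power[OF sf] pol fracs_poly AB)
qed

end

text \<open>The logarithmic part of Liouville's theorem. The coefficients are all constants of the
  ambient field; the inductive form replaces indexed sums by rule induction.\<close>

inductive_set log_forms :: "('b::field \<Rightarrow> 'b) \<Rightarrow> 'b set \<Rightarrow> 'b set" for d L where
  log_forms_0: "0 \<in> log_forms d L"
| log_forms_step: "l \<in> log_forms d L \<Longrightarrow> c \<in> constants d \<Longrightarrow> u \<in> L \<Longrightarrow> u \<noteq> 0 \<Longrightarrow>
    l + c * (d u / u) \<in> log_forms d L"

definition liouville_forms :: "('b::field \<Rightarrow> 'b) \<Rightarrow> 'b set \<Rightarrow> 'b set" where
  "liouville_forms d L = {d v + l |v l. v \<in> L \<and> l \<in> log_forms d L}"

lemma log_forms_cmult:
  assumes "derivation d" "c \<in> constants d" "l \<in> log_forms d L"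
  shows "c * l \<in> log_forms d L"
  using assms(3)
proof induction
  case (log_forms_step l c' u)
  then have "c * l + (c * c') * (d u / u) \<in> log_forms d L"
    by (intro log_forms.log_forms_step constants_mult assms)
  then show ?case by (simp add: algebra_simps)
qed (simp add: log_forms_0)

lemma log_forms_subset:
  assumes "subfield L" "constants d \<subseteq> L" "\<And>a. a \<in> L \<Longrightarrow> d a \<in> L"
  shows "log_forms d L \<subseteq> L"
proof
  fix l assume "l \<in> log_forms d L"
  then show "l \<in> L"
    by induction (use assms in \<open>auto intro!: subfield_0 subfield_add subfield_mult subfield_divide\<close>)
qed

section \<open>Descent through a transcendental logarithm or exponential\<close>

definition transcendental_over :: "'b::field set \<Rightarrow> 'b \<Rightarrow> bool" where
  "transcendental_over L t \<longleftrightarrow> (\<forall>A\<in>polys_over L. poly A t = 0 \<longrightarrow> A = 0)"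

text \<open>The fractions vanishing at infinity. They complement L[t] in L(t), and d preserves both
  summands when d t is at most linear in t, because then the degree of a polynomial does not
  grow.\<close>

definition proper_fracs :: "'b::field set \<Rightarrow> 'b \<Rightarrow> 'b set" where
  "proper_fracs L t = {poly R t / poly B t |R B. R \<in> polys_over L \<and> B \<in> polys_over L \<and>
     degree R < degree B \<and> poly B t \<noteq> 0}"

lemma coeff_pder_linear:
  assumes "derivation d"
  shows "coeff (pder d [:w0, w1:] A) k =
    d (coeff A k) + w0 * of_nat (Suc k) * coeff A (Suc k) + w1 * of_nat k * coeff A k"
proof -
  have "[:w0, w1:] * pderiv A = Polynomial.smult w0 (pderiv A) + pCons 0 (Polynomial.smult w1 (pderiv A))" by simp
  then show ?thesis
    by (cases k) (simp_all add: pder_def coeff_map_poly derivation_0[OF assms] coeff_pderiv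
      algebra_simps)
qed

lemma degree_pder_linear:
  assumes "derivation d"
  shows "degree (pder d [:w0, w1:] A) \<le> degree A"
  by (rule degree_le)
    (simp add: coeff_pder_linear[OF assms] coeff_eq_0 derivation_0[OF assms])

text \<open>One form covers both kinds of generator: w1 = 0 with w0 = d a / a is a logarithm, w0 = 0
  with w1 = d a an exponential. Since L contains all constants, t adds none.\<close>

locale transcendental_step =
  fixes d :: "'b::field \<Rightarrow> 'b" and L :: "'b set" and t w0 w1 :: 'b
  assumes char0: "\<And>n. 0 < n \<Longrightarrow> of_nat n \<noteq> (0::'b)"
    and d: "derivation d" and L: "subfield L" and const: "constants d \<subseteq> L"
    and Ld: "\<And>a. a \<in> L \<Longrightarrow> d a \<in> L"
    and trans: "transcendental_over L t"
    and w: "w0 \<in> L" "w1 \<in> L" and dt: "d t = w0 + w1 * t"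
begin

abbreviation "Delta \<equiv> pder d [:w0, w1:]"

lemma Delta: "d (poly A t) = poly (Delta A) t"
  by (rule derivation_poly_pder[OF d]) (simp add: dt algebra_simps)

lemma Delta_closed: "A \<in> polys_over L \<Longrightarrow> Delta A \<in> polys_over L"
  by (intro polys_over_pder L d Ld polys_over_pCons polys_over_0 w)

lemma poly_nz: "A \<in> polys_over L \<Longrightarrow> A \<noteq> 0 \<Longrightarrow> poly A t \<noteq> 0"
  using trans by (auto simp: transcendental_over_def)

lemma properI:
  assumes "R \<in> polys_over L" "B \<in> polys_over L" "degree R < degree B" "h = poly R t / poly B t"
  shows "h \<in> proper_fracs L t"
proof -
  have "B \<noteq> 0" using assms by auto
  then show ?thesis using poly_nz assms unfolding proper_fracs_def by blast
qed

lemma properE: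
  assumes "h \<in> proper_fracs L t"
  obtains R B where "R \<in> polys_over L" "B \<in> polys_over L" "degree R < degree B"
    "poly B t \<noteq> 0" "h = poly R t / poly B t"
  using assms unfolding proper_fracs_def by blast

lemma proper_0: "0 \<in> proper_fracs L t"
  by (rule properI[of 0 "[:0, 1:]"])
    (auto intro!: polys_over_pCons L polys_over_0 subfield_0 subfield_1)

lemma proper_cmult:
  assumes "c \<in> L" "h \<in> proper_fracs L t" shows "c * h \<in> proper_fracs L t"
  using assms(2)
proof (rule properE)
  fix R B assume *: "R \<in> polys_over L" "B \<in> polys_over L" "degree R < degree B"
    "poly B t \<noteq> 0" "h = poly R t / poly B t"
  then show ?thesis
    by (intro properI[of "Polynomial.smult c R" B])
      (auto intro: polys_over_smult[OF L assms(1)] le_less_trans[OF degree_smult_le])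
qed

lemma proper_add:
  assumes "h \<in> proper_fracs L t" "h' \<in> proper_fracs L t" shows "h + h' \<in> proper_fracs L t"
proof -
  from assms(1) obtain R B where R: "R \<in> polys_over L" "B \<in> polys_over L" "degree R < degree B"
    "poly B t \<noteq> 0" "h = poly R t / poly B t" by (rule properE)
  from assms(2) obtain R' B' where R': "R' \<in> polys_over L" "B' \<in> polys_over L" "degree R' < degree B'"
    "poly B' t \<noteq> 0" "h' = poly R' t / poly B' t" by (rule properE)
  have nz: "B \<noteq> 0" "B' \<noteq> 0" using R R' by auto
  have "degree (R * B' + R' * B) < degree (B * B')"
    using R(3) R'(3) nz
    by (intro degree_add_less le_less_trans[OF degree_mult_le]) (simp_all add: degree_mult_eq)
  then show ?thesis using R R'
    by (intro properI[of "R * B' + R' * B" "B * B'"])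
      (auto intro!: polys_over_add polys_over_mult L simp: add_frac_eq)
qed

lemma proper_deriv:
  assumes "h \<in> proper_fracs L t" shows "d h \<in> proper_fracs L t"
proof -
  from assms(1) obtain R B where R: "R \<in> polys_over L" "B \<in> polys_over L" "degree R < degree B"
    "poly B t \<noteq> 0" "h = poly R t / poly B t" by (rule properE)
  have nz: "B \<noteq> 0" using R by auto
  have "degree (Delta R * B - R * Delta B) < degree (B ^ 2)"
    using R(3) nz degree_pder_linear[OF d, of w0 w1 R] degree_pder_linear[OF d, of w0 w1 B]
    by (intro degree_diff_less le_less_trans[OF degree_mult_le])
      (simp_all add: degree_mult_eq power2_eq_square)
  then show ?thesis using R
    by (intro properI[of "Delta R * B - R * Delta B" "B ^ 2"])
      (auto intro!: polys_over_diff polys_over_mult polys_over_power L Delta_closed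
        simp: derivation_divide[OF d] Delta)
qed

lemma proper_poly_eq_0:
  assumes P: "P \<in> polys_over L" and "poly P t \<in> proper_fracs L t" shows "P = 0"
proof (rule ccontr)
  assume "P \<noteq> 0"
  from assms(2) obtain R B where R: "R \<in> polys_over L" "B \<in> polys_over L" "degree R < degree B"
    "poly B t \<noteq> 0" "poly P t = poly R t / poly B t" by (rule properE)
  then have "poly (P * B - R) t = 0" by (simp add: field_simps)
  moreover have "P * B - R \<in> polys_over L" by (intro polys_over_diff polys_over_mult L P R)
  ultimately have "P * B = R" using poly_nz by (metis eq_iff_diff_eq_0)
  moreover have "B \<noteq> 0" using R by auto
  ultimately show False using R(3) \<open>P \<noteq> 0\<close> by (auto simp: degree_mult_eq)
qed

lemma frac_split:
  assumes "v \<in> fracs L t"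
  obtains P r where "P \<in> polys_over L" "r \<in> proper_fracs L t" "v = poly P t + r"
proof -
  from assms obtain A B where AB: "A \<in> polys_over L" "B \<in> polys_over L" "poly B t \<noteq> 0"
      "v = poly A t / poly B t" by (rule fracsE)
  define r where "r = poly (A mod B) t / poly B t"
  have "r \<in> proper_fracs L t"
  proof (cases "A mod B = 0")
    case False
    then have "degree (A mod B) < degree B"
      using AB by (intro degree_mod_less') auto
    then show ?thesis using AB unfolding r_def
      by (intro properI[OF polys_over_mod[OF L] _ _ refl])
  qed (simp add: r_def proper_0)
  moreover have "v = poly (A div B) t + r"
  proof -
    have "poly A t = poly (A div B * B + A mod B) t" by simp
    also have "\<dots> = poly (A div B) t * poly B t + poly (A mod B) t"
      by (simp only: poly_add poly_mult)
    finally show ?thesis using AB by (simp add: r_def field_simps)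
  qed
  ultimately show thesis using that polys_over_div[OF L AB(2,1)] by blast
qed

text \<open>The value of the logarithmic derivative at infinity depends only on the leading term of
  A: its coefficient contributes one logarithmic derivative and each factor t contributes
  w1.\<close>

lemma logderiv_poly:
  assumes A: "A \<in> polys_over L" "A \<noteq> 0"
  obtains r where "r \<in> proper_fracs L t"
    "d (poly A t) / poly A t = d (lead_coeff A) / lead_coeff A + of_nat (degree A) * w1 + r"
proof -
  \<comment> \<open>This is the value at infinity, chosen so that the top coefficient of
    \<open>N\<close> below cancels.\<close>
  define s where "s = d (lead_coeff A) / lead_coeff A + of_nat (degree A) * w1"
  define N where "N = Delta A - Polynomial.smult s A"
  have sL: "s \<in> L"
    unfolding s_def by (intro subfield_intros L Ld polys_over_coeff[OF A(1)] w)
  have N: "N \<in> polys_over L"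
    unfolding N_def by (intro polys_over_diff polys_over_smult L Delta_closed A sL)
  have "degree N \<le> degree A"
    unfolding N_def using degree_pder_linear[OF d] by (intro degree_diff_le) auto
  moreover have "coeff N (degree A) = 0"
    using A by (simp add: N_def s_def coeff_pder_linear[OF d] coeff_eq_0 field_simps)
  ultimately have "N = 0 \<or> degree N < degree A"
    by (metis leading_coeff_0_iff le_neq_implies_less)
  then have "poly N t / poly A t \<in> proper_fracs L t"
    using properI[OF N A(1)] proper_0 by auto
  moreover have "d (poly A t) / poly A t = s + poly N t / poly A t"
    using poly_nz[OF A] by (simp add: Delta N_def field_simps)
  ultimately show thesis using that unfolding s_def by blast
qed

lemma logderiv_frac:
  assumes u: "u \<in> fracs L t" "u \<noteq> 0"
  obtains e k r where "e \<in> L" "e \<noteq> 0" "k \<in> constants d" "r \<in> proper_fracs L t"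
    "d u / u = d e / e + k * w1 + r"
proof -
  from u obtain A B where AB: "A \<in> polys_over L" "B \<in> polys_over L" "poly B t \<noteq> 0"
      "u = poly A t / poly B t" by (metis fracsE)
  have nz: "A \<noteq> 0" "B \<noteq> 0" using AB u by auto
  obtain r where r: "r \<in> proper_fracs L t"
    "d (poly A t) / poly A t = d (lead_coeff A) / lead_coeff A + of_nat (degree A) * w1 + r"
    using logderiv_poly[OF AB(1) nz(1)] .
  obtain r' where r': "r' \<in> proper_fracs L t"
    "d (poly B t) / poly B t = d (lead_coeff B) / lead_coeff B + of_nat (degree B) * w1 + r'"
    using logderiv_poly[OF AB(2) nz(2)] .
  have "r + (- 1) * r' \<in> proper_fracs L t"
    by (intro proper_add proper_cmult r r' subfield_uminus L subfield_1)
  then have rr: "r - r' \<in> proper_fracs L t" by simp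
  have "d u / u = d (poly A t) / poly A t - d (poly B t) / poly B t"
    unfolding AB(4) using poly_nz[OF AB(1) nz(1)] AB(3) by (rule logderiv_divide[OF d])
  also have "\<dots> = (d (lead_coeff A) / lead_coeff A - d (lead_coeff B) / lead_coeff B)
      + (of_nat (degree A) - of_nat (degree B)) * w1 + (r - r')"
    unfolding r r' by (simp add: algebra_simps)
  also have "d (lead_coeff A) / lead_coeff A - d (lead_coeff B) / lead_coeff B
      = d (lead_coeff A / lead_coeff B) / (lead_coeff A / lead_coeff B)"
    using nz by (intro logderiv_divide[OF d, symmetric]) auto
  finally show thesis using rr nz AB
    by (intro that[of "lead_coeff A / lead_coeff B" "of_nat (degree A) - of_nat (degree B)" "r - r'"])
      (auto intro!: subfield_divide[OF L] polys_over_coeff constants_diff[OF d] constants_of_nat[OF d])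
qed

lemma log_forms_split:
  assumes "l \<in> log_forms d (fracs L t)"
  shows "\<exists>l'\<in>log_forms d L. \<exists>c\<in>constants d. \<exists>r\<in>proper_fracs L t. l = l' + c * w1 + r"
  using assms
proof induction
  case log_forms_0
  then show ?case
    by (intro bexI[of _ 0]) (auto intro: log_forms.intros proper_0 constants_0[OF d])
next
  case (log_forms_step l c u)
  from log_forms_step.IH obtain l' c' r where IH: "l' \<in> log_forms d L" "c' \<in> constants d"
    "r \<in> proper_fracs L t" "l = l' + c' * w1 + r" by blast
  from log_forms_step.hyps obtain e k r' where e: "e \<in> L" "e \<noteq> 0" "k \<in> constants d"
    "r' \<in> proper_fracs L t" "d u / u = d e / e + k * w1 + r'" by (metis logderiv_frac)
  have "l + c * (d u / u) = (l' + c * (d e / e)) + (c' + c * k) * w1 + (r + c * r')"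
    unfolding IH(4) e(5) by (simp add: algebra_simps)
  moreover have "l' + c * (d e / e) \<in> log_forms d L"
    using IH e log_forms_step.hyps by (intro log_forms.log_forms_step)
  moreover have "c' + c * k \<in> constants d"
    using IH e log_forms_step.hyps by (intro constants_add constants_mult d)
  moreover have "r + c * r' \<in> proper_fracs L t"
    using IH e log_forms_step.hyps const by (intro proper_add proper_cmult) auto
  ultimately show ?case by blast
qed

text \<open>Both summands of a Liouville form over \<open>L(t)\<close> are split at infinity into a polynomial and
  a proper fraction; by transcendence only the polynomial parts contribute to an element of \<open>L\<close>.\<close>

lemma liouville_forms_polynomial_part:
  assumes h: "h \<in> L" "h \<in> liouville_forms d (fracs L t)"
  obtains P l c where "P \<in> polys_over L" "l \<in> log_forms d L" "c \<in> constants d"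
    "h = d (coeff P 0) + w0 * coeff P 1 + l + c * w1"
    "\<And>k. 0 < k \<Longrightarrow> d (coeff P k) + w0 * of_nat (Suc k) * coeff P (Suc k) + w1 * of_nat k * coeff P k = 0"
proof -
  from h(2) obtain v l where vl: "v \<in> fracs L t" "l \<in> log_forms d (fracs L t)" "h = d v + l"
    unfolding liouville_forms_def by blast
  from frac_split[OF vl(1)] obtain P r where P: "P \<in> polys_over L" "r \<in> proper_fracs L t"
    "v = poly P t + r" by blast
  from log_forms_split[OF vl(2)] obtain l' c r' where l': "l' \<in> log_forms d L" "c \<in> constants d"
    "r' \<in> proper_fracs L t" "l = l' + c * w1 + r'" by blast
  \<comment> \<open>\<open>G\<close> is the polynomial part of d v + l - h. What is left is proper,
    so both must vanish.\<close>
  define G where "G = Delta P + [:l' + c * w1 - h:]"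
  have "l' + c * w1 - h \<in> L"
    using l' const log_forms_subset[OF L const Ld] by (intro subfield_intros L w h) auto
  then have G: "G \<in> polys_over L"
    unfolding G_def by (intro polys_over_add polys_over_pCons polys_over_0 L Delta_closed P)
  have "poly G t = (- 1) * (d r + r')"
    using vl(3) by (simp add: G_def P(3) l'(4) derivation_add[OF d] Delta)
  also have "\<dots> \<in> proper_fracs L t"
    by (intro proper_cmult proper_add proper_deriv P l' subfield_uminus L subfield_1)
  finally have "G = 0" by (rule proper_poly_eq_0[OF G])
  then have c: "coeff (Delta P) k + coeff [:l' + c * w1 - h:] k = 0" for k
    by (metis G_def coeff_0 coeff_add)
  show thesis
  proof (rule that[OF P(1) l'(1,2)])
    show "h = d (coeff P 0) + w0 * coeff P 1 + l' + c * w1"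
      using c[of 0] by (simp add: coeff_pder_linear[OF d] algebra_simps)
    show "d (coeff P k) + w0 * of_nat (Suc k) * coeff P (Suc k) + w1 * of_nat k * coeff P k = 0"
      if "0 < k" for k
      using c[of k] that by (simp add: coeff_pder_linear[OF d] coeff_pCons split: nat.splits)
  qed
qed

text \<open>Only the constant coefficient of the polynomial part matters, and the contribution c * d
  a from infinity is itself the derivative of c * a.\<close>

lemma descent_exp:
  assumes h: "h \<in> L" "h \<in> liouville_forms d (fracs L t)" and "w0 = 0" "w1 = d a" "a \<in> L"
  shows "h \<in> liouville_forms d L"
proof -
  obtain P l c where P: "P \<in> polys_over L" "l \<in> log_forms d L" "c \<in> constants d"
    "h = d (coeff P 0) + w0 * coeff P 1 + l + c * w1"
    by (rule liouville_forms_polynomial_part[OF h])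
  then have "h = d (coeff P 0 + c * a) + l"
    by (simp add: assms derivation_add[OF d] derivation_cmult[OF d])
  moreover have "coeff P 0 + c * a \<in> L"
    using P const assms by (intro subfield_intros L polys_over_coeff) auto
  ultimately show ?thesis using P unfolding liouville_forms_def by blast
qed

text \<open>The polynomial part turns out to have degree at most 1 with constant linear coefficient;
  that coefficient times d t = d a / a becomes one more logarithmic term over L.\<close>

lemma descent_log:
  assumes h: "h \<in> L" "h \<in> liouville_forms d (fracs L t)"
    and w01: "w1 = 0" "w0 = d a / a" "a \<in> L" "a \<noteq> 0"
  shows "h \<in> liouville_forms d L"
proof -
  obtain P l c where P: "P \<in> polys_over L" "l \<in> log_forms d L" "c \<in> constants d"
    "h = d (coeff P 0) + w0 * coeff P 1 + l + c * w1" and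
    co: "\<And>k. 0 < k \<Longrightarrow> d (coeff P k) + w0 * of_nat (Suc k) * coeff P (Suc k) + w1 * of_nat k * coeff P k = 0"
    using liouville_forms_polynomial_part[OF h] by metis
  have "degree P \<le> 1"
  proof (rule ccontr)
    assume deg: "\<not> degree P \<le> 1"
    define n where "n = degree P - 2"
    have n: "degree P = Suc (Suc n)" using deg by (simp add: n_def)
    have lc: "d (lead_coeff P) = 0"
      using co[of "Suc (Suc n)"] n by (simp add: w01 coeff_eq_0)
    \<comment> \<open>The coefficient equation one place below the top says that t plus the second
      coefficient divided by the constant \<open>e\<close> has derivative 0. Being a constant it
      lies in L, which puts t into L.\<close>
    define e where "e = of_nat (Suc (Suc n)) * lead_coeff P"
    have e0: "e \<noteq> 0" using char0[of "Suc (Suc n)"] deg unfolding e_def by auto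
    have de: "d e = 0"
      unfolding e_def using lc by (simp add: derivation_mult[OF d] derivation_of_nat[OF d] del: of_nat_Suc)
    have "d (coeff P (Suc n)) + w0 * e = 0"
      using co[of "Suc n"] n by (simp add: w01 e_def algebra_simps)
    moreover have "d (coeff P (Suc n) / e) = d (coeff P (Suc n)) / e"
      using e0 by (simp add: derivation_divide[OF d] de power2_eq_square)
    then have "d (t + coeff P (Suc n) / e) = w0 + d (coeff P (Suc n)) / e"
      by (simp add: derivation_add[OF d] dt w01(1))
    ultimately have "d (t + coeff P (Suc n) / e) = 0"
      using e0 by (simp add: field_simps)
    then have "t + coeff P (Suc n) / e \<in> L" using const by (auto simp: constants_def)
    moreover have "coeff P (Suc n) / e \<in> L"
      unfolding e_def by (intro subfield_intros L polys_over_coeff[OF P(1)])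
    ultimately have "(t + coeff P (Suc n) / e) - coeff P (Suc n) / e \<in> L"
      by (rule subfield_diff[OF L])
    then have "t \<in> L" by simp
    then have "[:- t, 1:] \<in> polys_over L"
      by (intro polys_over_pCons polys_over_0 L subfield_intros)
    from poly_nz[OF this] show False by simp
  qed
  \<comment> \<open>With this, the equation for k = 1 reduces to d (coeff P 1) = 0.\<close>
  then have "coeff P 2 = 0" by (simp add: coeff_eq_0)
  then have "coeff P 1 \<in> constants d"
    using co[of 1] by (simp add: constants_def w01 numeral_2_eq_2)
  then have "l + coeff P 1 * (d a / a) \<in> log_forms d L"
    using P w01 by (intro log_forms.log_forms_step)
  moreover have "h = d (coeff P 0) + (l + coeff P 1 * (d a / a))"
    using P(4) by (simp add: w01)
  ultimately show ?thesis using polys_over_coeff[OF P(1)] unfolding liouville_forms_def by blast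
qed

end

section \<open>Algebraic extensions\<close>

definition mat_trace :: "'b::comm_ring_1 mat \<Rightarrow> 'b" where
  "mat_trace A = (\<Sum>i<dim_row A. A $$ (i, i))"

lemma mat_trace_add: "A \<in> carrier_mat n n \<Longrightarrow> B \<in> carrier_mat n n \<Longrightarrow>
    mat_trace (A + B) = mat_trace A + mat_trace B"
  by (auto simp: mat_trace_def sum.distrib)

lemma mat_trace_smult: "A \<in> carrier_mat n n \<Longrightarrow> mat_trace (c \<cdot>\<^sub>m A) = c * mat_trace A"
  by (auto simp: mat_trace_def sum_distrib_left)

lemma mat_trace_mult:
  "A \<in> carrier_mat n n \<Longrightarrow> B \<in> carrier_mat n n \<Longrightarrow>
    mat_trace (A * B) = (\<Sum>i<n. \<Sum>j<n. A $$ (i, j) * B $$ (j, i))"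
  by (auto simp: mat_trace_def scalar_prod_def atLeast0LessThan intro!: sum.cong)

lemma mat_trace_mult_commute:
  "A \<in> carrier_mat n n \<Longrightarrow> B \<in> carrier_mat n n \<Longrightarrow> mat_trace (A * B) = mat_trace (B * A)"
  unfolding mat_trace_mult[of A n B] mat_trace_mult[of B n A]
  by (subst sum.swap) (simp add: mult.commute)

lemma derivation_prod:
  assumes d: "derivation d" and "finite I"
  shows "d (prod f I) = (\<Sum>k\<in>I. d (f k) * prod f (I - {k}))"
  using assms(2)
proof induction
  case (insert i I)
  have "prod f (insert i I - {k}) = f i * prod f (I - {k})" if "k \<in> I" for k
  proof -
    have "insert i I - {k} = insert i (I - {k})" using that insert by auto
    then show ?thesis using insert by simp
  qed
  then have "(\<Sum>k\<in>I. d (f k) * prod f (insert i I - {k})) = f i * d (prod f I)"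
    unfolding insert.IH sum_distrib_left by (intro sum.cong) (simp_all add: algebra_simps)
  then show ?case using insert by (simp add: derivation_mult[OF d])
qed (simp add: derivation_1[OF d])

lemma derivation_signof: "derivation d \<Longrightarrow> d (signof p) = 0"
  by (simp add: sign_def derivation_1 derivation_uminus)

text \<open>Jacobi's formula. The product rule turns the derivative into a sum of determinants
  \<open>det (R k)\<close> with row k differentiated; Laplace expansion along that row yields
  cofactors of B itself, since deleting row k removes the only change.\<close>

lemma derivation_det:
  assumes d: "derivation d" and B: "B \<in> carrier_mat n n"
  shows "d (det B) = mat_trace (map_mat d B * adj_mat B)"
proof -
  define R where "R k = mat n n (\<lambda>(i, j). if i = k then d (B $$ (k, j)) else B $$ (i, j))" for k
  have R: "R k \<in> carrier_mat n n" for k by (simp add: R_def)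
  have "d (\<Prod>i = 0..<n. B $$ (i, p i)) = (\<Sum>k<n. \<Prod>i = 0..<n. R k $$ (i, p i))"
    if p: "p permutes {0..<n}" for p
  proof -
    have pn: "p i < n" if "i < n" for i using permutes_in_image[OF p, of i] that by simp
    have "(\<Prod>i = 0..<n. R k $$ (i, p i)) = d (B $$ (k, p k)) * (\<Prod>i\<in>{0..<n} - {k}. B $$ (i, p i))"
      if k: "k < n" for k
    proof -
      have "(\<Prod>i = 0..<n. R k $$ (i, p i)) = R k $$ (k, p k) * (\<Prod>i\<in>{0..<n} - {k}. R k $$ (i, p i))"
        using k by (intro prod.remove) auto
      also have "(\<Prod>i\<in>{0..<n} - {k}. R k $$ (i, p i)) = (\<Prod>i\<in>{0..<n} - {k}. B $$ (i, p i))"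
        by (intro prod.cong) (auto simp: R_def pn)
      finally show ?thesis using k pn by (simp add: R_def)
    qed
    then show ?thesis
      by (subst derivation_prod[OF d]) (auto simp: atLeast0LessThan intro!: sum.cong)
  qed
  then have "d (det B) = (\<Sum>p | p permutes {0..<n}. signof p * (\<Sum>k<n. \<Prod>i = 0..<n. R k $$ (i, p i)))"
    unfolding det_def'[OF B] derivation_sum[OF d]
    by (intro sum.cong) (simp_all add: derivation_mult[OF d] derivation_signof[OF d])
  also have "\<dots> = (\<Sum>k<n. det (R k))"
    unfolding det_def'[OF R] sum_distrib_left by (rule sum.swap)
  also have "\<dots> = (\<Sum>k<n. \<Sum>j<n. d (B $$ (k, j)) * cofactor B k j)"
  proof (rule sum.cong)
    fix k assume k: "k \<in> {..<n}"
    have cof: "cofactor (R k) k j = cofactor B k j" for j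
    proof -
      have "mat_delete (R k) k j = mat_delete B k j"
        unfolding mat_delete_def using B by (intro cong_mat) (auto simp: R_def)
      then show ?thesis by (simp add: cofactor_def)
    qed
    have "det (R k) = (\<Sum>j<n. R k $$ (k, j) * cofactor (R k) k j)"
      using k by (intro laplace_expansion_row[OF R]) simp
    also have "\<dots> = (\<Sum>j<n. d (B $$ (k, j)) * cofactor B k j)"
      unfolding cof using k by (intro sum.cong) (simp_all add: R_def)
    finally show "det (R k) = (\<Sum>j<n. d (B $$ (k, j)) * cofactor B k j)" .
  qed simp
  also have "\<dots> = mat_trace (map_mat d B * adj_mat B)"
    using B by (subst mat_trace_mult[of _ n]) (auto simp: adj_mat_def intro!: sum.cong)
  finally show ?thesis .
qed

section \<open>Trace and norm for a simple algebraic extension\<close>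

locale algebraic_step =
  fixes d :: "'b::field \<Rightarrow> 'b" and L :: "'b set" and t :: 'b
  assumes char0: "\<And>n. 0 < n \<Longrightarrow> of_nat n \<noteq> (0::'b)"
    and d: "derivation d" and L: "subfield L" and const: "constants d \<subseteq> L"
    and Ld: "\<And>a. a \<in> L \<Longrightarrow> d a \<in> L"
    and alg: "\<not> transcendental_over L t"
begin

text \<open>Not normalised to be monic; the arguments use only that its degree is least among the
  nonzero polynomials over L vanishing at t.\<close>

definition minpoly :: "'b poly" where
  "minpoly = (SOME G. G \<in> polys_over L \<and> poly G t = 0 \<and> G \<noteq> 0 \<and>
    (\<forall>A\<in>polys_over L. poly A t = 0 \<longrightarrow> G dvd A \<and> (A \<noteq> 0 \<longrightarrow> degree G \<le> degree A)))"

lemma minpoly: "minpoly \<in> polys_over L" "poly minpoly t = 0" "minpoly \<noteq> 0"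
  and minpoly_min: "A \<in> polys_over L \<Longrightarrow> poly A t = 0 \<Longrightarrow> A \<noteq> 0 \<Longrightarrow> degree minpoly \<le> degree A"
proof -
  define I where "I = {A \<in> polys_over L. poly A t = 0}"
  obtain A0 where "A0 \<in> I" "A0 \<noteq> 0" using alg by (auto simp: transcendental_over_def I_def)
  moreover have "I \<subseteq> polys_over L" by (auto simp: I_def)
  moreover have "A - B * Q \<in> I" if "A \<in> I" "B \<in> I" "Q \<in> polys_over L" for A B Q
    using that by (auto simp: I_def intro!: polys_over_diff polys_over_mult L)
  ultimately have "\<exists>G\<in>I. G \<noteq> 0 \<and> (\<forall>A\<in>I. G dvd A \<and> (A \<noteq> 0 \<longrightarrow> degree G \<le> degree A))"
    using polys_over_principal[OF L] by blast
  then have "\<exists>G. G \<in> polys_over L \<and> poly G t = 0 \<and> G \<noteq> 0 \<and>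
    (\<forall>A\<in>polys_over L. poly A t = 0 \<longrightarrow> G dvd A \<and> (A \<noteq> 0 \<longrightarrow> degree G \<le> degree A))"
    unfolding I_def by blast
  from someI_ex[OF this]
  have *: "minpoly \<in> polys_over L \<and> poly minpoly t = 0 \<and> minpoly \<noteq> 0 \<and>
    (\<forall>A\<in>polys_over L. poly A t = 0 \<longrightarrow> minpoly dvd A \<and> (A \<noteq> 0 \<longrightarrow> degree minpoly \<le> degree A))"
    unfolding minpoly_def .
  then show "minpoly \<in> polys_over L" "poly minpoly t = 0" "minpoly \<noteq> 0" by auto
  show "A \<in> polys_over L \<Longrightarrow> poly A t = 0 \<Longrightarrow> A \<noteq> 0 \<Longrightarrow> degree minpoly \<le> degree A"
    using * by blast
qed

abbreviation "n \<equiv> degree minpoly"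
abbreviation "F \<equiv> fracs L t"

lemma n_pos: "0 < n"
proof (rule ccontr)
  assume "\<not> 0 < n"
  then obtain c where "minpoly = [:c:]" by (auto elim: degree_eq_zeroE)
  then show False using minpoly by auto
qed

lemma F: "subfield F"
  by (rule subfield_fracs[OF L])

lemma LF: "a \<in> L \<Longrightarrow> a \<in> F"
  using fracs_superset[OF L] by blast

lemma tF: "t \<in> F"
  by (rule fracs_generator[OF L])

text \<open>The gcd of B and \<open>minpoly\<close> does not vanish at t because it divides B. Hence
  the complementary factor of \<open>minpoly\<close> vanishes there and has full degree, so the gcd
  is constant and the Bezout cofactor of B gives the inverse.\<close>

lemma inverse_poly:
  assumes B: "B \<in> polys_over L" "poly B t \<noteq> 0"
  obtains V where "V \<in> polys_over L" "inverse (poly B t) = poly V t"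
proof -
  from polys_over_bezout[OF L minpoly(1,3) B(1)] obtain U V where UV: "U \<in> polys_over L"
    "V \<in> polys_over L" and H: "U * minpoly + V * B \<noteq> 0" "U * minpoly + V * B dvd minpoly"
      "U * minpoly + V * B dvd B" by blast
  define H where "H = U * minpoly + V * B"
  have HL: "H \<in> polys_over L"
    unfolding H_def by (intro polys_over_add polys_over_mult L UV minpoly B)
  have Ht: "poly H t = poly V t * poly B t" by (simp add: H_def minpoly)
  have "poly H t \<noteq> 0" using B H(3) unfolding H_def by (metis dvdE mult_zero_left poly_mult)
  obtain Q where Q: "Q \<in> polys_over L" "minpoly = H * Q"
    using polys_over_dvdE[OF L HL minpoly(1)] H(2) unfolding H_def by blast
  have "Q \<noteq> 0" "H \<noteq> 0" using Q minpoly(3) by auto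
  moreover have "poly H t * poly Q t = 0" using Q(2) minpoly(2) by (metis poly_mult)
  then have "poly Q t = 0" using \<open>poly H t \<noteq> 0\<close> by simp
  ultimately have "degree H = 0" using minpoly_min[OF Q(1)] Q(2) by (simp add: degree_mult_eq)
  then obtain c where c: "H = [:c:]" by (rule degree_eq_zeroE)
  have "c \<in> L" using polys_over_coeff[OF HL, of 0] by (simp add: c)
  then have "Polynomial.smult (inverse c) V \<in> polys_over L"
    by (intro polys_over_smult subfield_inverse L UV)
  moreover have "inverse (poly B t) = poly (Polynomial.smult (inverse c) V) t"
    using Ht \<open>poly H t \<noteq> 0\<close> B by (simp add: c field_simps)
  ultimately show thesis by (rule that)
qed

lemma reduced_rep_ex:
  assumes "y \<in> F"
  shows "\<exists>A. A \<in> polys_over L \<and> degree A < n \<and> poly A t = y"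
proof -
  from assms obtain A B where AB: "A \<in> polys_over L" "B \<in> polys_over L" "poly B t \<noteq> 0"
    "y = poly A t / poly B t" by (rule fracsE)
  obtain V where V: "V \<in> polys_over L" "inverse (poly B t) = poly V t"
    using inverse_poly[OF AB(2,3)] .
  define R where "R = (A * V) mod minpoly"
  have "R \<in> polys_over L"
    unfolding R_def by (intro polys_over_mod polys_over_mult L AB V minpoly)
  moreover have "degree R < n"
    using degree_mod_less[OF minpoly(3), of "A * V"] n_pos by (auto simp: R_def)
  moreover have "A * V = A * V div minpoly * minpoly + R"
    unfolding R_def by (rule div_mult_mod_eq[symmetric])
  then have "poly A t * poly V t = poly R t" using minpoly(2) by (metis poly_add poly_mult
      mult_zero_right add_0)
  then have "poly R t = y" using AB V by (simp add: divide_inverse)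
  ultimately show ?thesis by blast
qed

definition rep :: "'b \<Rightarrow> 'b poly" where
  "rep y = (SOME A. A \<in> polys_over L \<and> degree A < n \<and> poly A t = y)"

lemma rep: "y \<in> F \<Longrightarrow> rep y \<in> polys_over L" "y \<in> F \<Longrightarrow> degree (rep y) < n"
  "y \<in> F \<Longrightarrow> poly (rep y) t = y"
  using someI_ex[OF reduced_rep_ex] unfolding rep_def by blast+

lemma rep_unique:
  assumes "A \<in> polys_over L" "degree A < n" "poly A t = y"
  shows "rep y = A"
proof (rule ccontr)
  assume ne: "rep y \<noteq> A"
  have y: "y \<in> F" using fracs_poly[OF L assms(1)] assms(3) by metis
  have "rep y - A \<in> polys_over L" using rep y assms by (intro polys_over_diff L)
  moreover have "poly (rep y - A) t = 0" using rep y assms by simp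
  ultimately have "n \<le> degree (rep y - A)" using ne by (intro minpoly_min) auto
  moreover have "degree (rep y - A) < n" using rep(2)[OF y] assms(2) by (rule degree_diff_less)
  ultimately show False by simp
qed

text \<open>The i-th coordinate of y in the L-basis 1, t, ..., t^(n-1) of L(t).\<close>

definition co :: "nat \<Rightarrow> 'b \<Rightarrow> 'b" where
  "co i y = coeff (rep y) i"

lemma co_L: "y \<in> F \<Longrightarrow> co i y \<in> L"
  by (simp add: co_def polys_over_coeff rep)

lemma co_add: "y \<in> F \<Longrightarrow> z \<in> F \<Longrightarrow> co i (y + z) = co i y + co i z"
  unfolding co_def
  by (subst rep_unique[of "rep y + rep z"]) (auto simp: rep intro: polys_over_add[OF L] degree_add_less)

lemma co_cmult: "c \<in> L \<Longrightarrow> y \<in> F \<Longrightarrow> co i (c * y) = c * co i y"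
  unfolding co_def
  by (subst rep_unique[of "Polynomial.smult c (rep y)"])
    (auto simp: rep n_pos intro: polys_over_smult[OF L] le_less_trans[OF degree_smult_le])

lemma co_0: "co i 0 = 0"
  using co_cmult[of 0 0 i] LF[OF subfield_0[OF L]] subfield_0[OF L] by simp

lemma co_sum: "(\<And>k. k \<in> K \<Longrightarrow> y k \<in> F) \<Longrightarrow> co i (sum y K) = (\<Sum>k\<in>K. co i (y k))"
  by (induction K rule: infinite_finite_induct)
    (simp_all add: co_0 co_add subfield_sum[OF F])

lemma co_power: "k < n \<Longrightarrow> co i (t ^ k) = (if i = k then 1 else 0)"
  unfolding co_def
  by (subst rep_unique[of "monom 1 k"])
    (auto simp: poly_monom degree_monom_eq intro: polys_over_monom[OF L] subfield_1[OF L])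

lemma co_expand: "y \<in> F \<Longrightarrow> y = (\<Sum>k<n. co k y * t ^ k)"
proof -
  assume y: "y \<in> F"
  have "y = (\<Sum>i\<le>degree (rep y). co i y * t ^ i)"
    using rep(3)[OF y] by (simp add: poly_altdef co_def)
  also have "\<dots> = (\<Sum>k<n. co k y * t ^ k)"
    using rep(2)[OF y] by (intro sum.mono_neutral_left) (auto simp: co_def coeff_eq_0)
  finally show ?thesis .
qed

text \<open>The regular representation of L(t) over L: multiplication by y in the basis of powers of
  t. Its trace and determinant are the trace and norm of y.\<close>

definition mulmat :: "'b \<Rightarrow> 'b mat" where
  "mulmat y = mat n n (\<lambda>(i, k). co i (y * t ^ k))"

lemma mulmat_carrier: "mulmat y \<in> carrier_mat n n"
  by (simp add: mulmat_def)

lemma powF: "t ^ k \<in> F"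
  by (intro subfield_power F tF)

lemma co_mult:
  assumes y: "y \<in> F" and z: "z \<in> F"
  shows "co i (y * z) = (\<Sum>j<n. co i (y * t ^ j) * co j z)"
proof -
  have "y * z = y * (\<Sum>j<n. co j z * t ^ j)" using co_expand[OF z] by simp
  also have "\<dots> = (\<Sum>j<n. co j z * (y * t ^ j))"
    by (simp add: sum_distrib_left algebra_simps)
  also have "co i \<dots> = (\<Sum>j<n. co j z * co i (y * t ^ j))"
    using y z by (subst co_sum) (auto simp: co_cmult co_L subfield_mult F powF LF)
  finally show ?thesis by (simp add: mult.commute)
qed

lemma mulmat_mult: "y \<in> F \<Longrightarrow> z \<in> F \<Longrightarrow> mulmat (y * z) = mulmat y * mulmat z"
  by (rule eq_matI)
    (auto simp: mulmat_def scalar_prod_def mult.assoc co_mult[of y "z * t ^ _"] subfield_mult F powF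
      atLeast0LessThan)

lemma mulmat_1: "mulmat 1 = 1\<^sub>m n"
  by (rule eq_matI) (auto simp: mulmat_def co_power)

definition Tr :: "'b \<Rightarrow> 'b" where
  "Tr y = mat_trace (mulmat y)"

lemma Tr_altdef: "Tr y = (\<Sum>k<n. co k (y * t ^ k))"
  by (simp add: Tr_def mat_trace_def mulmat_def)

lemma Tr_add: "y \<in> F \<Longrightarrow> z \<in> F \<Longrightarrow> Tr (y + z) = Tr y + Tr z"
  by (simp add: Tr_altdef distrib_right co_add subfield_mult F powF sum.distrib)

lemma Tr_cmult: "c \<in> L \<Longrightarrow> y \<in> F \<Longrightarrow> Tr (c * y) = c * Tr y"
  by (simp add: Tr_altdef mult.assoc co_cmult subfield_mult F powF sum_distrib_left)

lemma Tr_base: "a \<in> L \<Longrightarrow> Tr a = of_nat n * a"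
  by (simp add: Tr_altdef co_cmult powF co_power)

lemma Tr_L: "y \<in> F \<Longrightarrow> Tr y \<in> L"
  unfolding Tr_altdef by (intro subfield_sum[OF L] co_L subfield_mult[OF F] powF)

text \<open>Implicit differentiation of minpoly(t) = 0. Characteristic 0 makes the formal derivative
  a nonzero polynomial of degree below n, so it does not vanish at t.\<close>

lemma dt: "d t \<in> F"
proof -
  define P where "P = pderiv minpoly"
  have P: "P \<in> polys_over L" unfolding P_def by (intro polys_over_pderiv L minpoly)
  have "coeff P (n - 1) = of_nat n * lead_coeff minpoly"
    using n_pos by (simp add: P_def coeff_pderiv)
  then have "P \<noteq> 0" using char0[OF n_pos] minpoly(3) by auto
  moreover have "degree P < n"
    using n_pos by (intro le_less_trans[OF degree_le[of "n - 1"]])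
      (auto simp: P_def coeff_pderiv coeff_eq_0)
  ultimately have Pt: "poly P t \<noteq> 0" using minpoly_min[OF P] by auto
  have "0 = d (poly minpoly t)" by (simp add: minpoly derivation_0[OF d])
  also have "\<dots> = poly (map_poly d minpoly) t + poly P t * d t"
    by (simp add: derivation_poly[OF d] P_def)
  finally have "d t = - poly (map_poly d minpoly) t / poly P t"
    using Pt by (simp add: field_simps eq_neg_iff_add_eq_0)
  also have "\<dots> \<in> F"
    by (intro subfield_divide[OF F] subfield_uminus[OF F] fracs_poly L polys_over_map_poly
        derivation_0[OF d] Ld minpoly P)
  finally show ?thesis .
qed

lemma Fd: "y \<in> F \<Longrightarrow> d y \<in> F"
  by (rule fracs_closed[OF L d Ld dt])

definition conn :: "'b mat" where
  "conn = mat n n (\<lambda>(i, k). co i (d (t ^ k)))"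

lemma conn_carrier: "conn \<in> carrier_mat n n"
  by (simp add: conn_def)

text \<open>The derivation acts on \<open>L(t)\<close> as the connection with matrix \<open>conn\<close>
  in the basis of powers of \<open>t\<close>.\<close>

lemma mulmat_deriv:
  assumes y: "y \<in> F"
  shows "mulmat (d y) + mulmat y * conn = map_mat d (mulmat y) + conn * mulmat y"
proof (rule eq_matI)
  fix i k assume "i < dim_row (map_mat d (mulmat y) + conn * mulmat y)"
    "k < dim_col (map_mat d (mulmat y) + conn * mulmat y)"
  then have ik: "i < n" "k < n" by (simp_all add: mulmat_def conn_def)
  define z where "z = y * t ^ k"
  have z: "z \<in> F" unfolding z_def by (intro subfield_mult F y powF)
  have "co i (d y * t ^ k) + co i (y * d (t ^ k)) = co i (d z)"
    using y by (simp add: z_def derivation_mult[OF d] co_add subfield_mult F powF Fd)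
  also have "d z = d (\<Sum>j<n. co j z * t ^ j)" using co_expand[OF z] by simp
  also have "\<dots> = (\<Sum>j<n. d (co j z) * t ^ j + co j z * d (t ^ j))"
    by (simp add: derivation_sum[OF d] derivation_mult[OF d])
  also have "co i \<dots> = (\<Sum>j<n. d (co j z) * co i (t ^ j) + co j z * co i (d (t ^ j)))"
    using z by (subst co_sum)
      (auto simp: co_add co_cmult co_L Ld LF subfield_mult subfield_add F Fd powF)
  also have "\<dots> = d (co i z) + (\<Sum>j<n. co i (d (t ^ j)) * co j z)"
  proof -
    have "(\<Sum>j<n. d (co j z) * co i (t ^ j)) = (\<Sum>j<n. if j = i then d (co j z) else 0)"
      by (intro sum.cong) (auto simp: co_power)
    then show ?thesis using ik by (simp add: sum.distrib mult.commute)
  qed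
  also have "co i (y * d (t ^ k)) = (\<Sum>j<n. co i (y * t ^ j) * co j (d (t ^ k)))"
    by (intro co_mult y Fd powF)
  finally show "(mulmat (d y) + mulmat y * conn) $$ (i, k)
      = (map_mat d (mulmat y) + conn * mulmat y) $$ (i, k)"
    using ik by (simp add: mulmat_def conn_def z_def scalar_prod_def atLeast0LessThan)
qed (simp_all add: mulmat_def conn_def)

text \<open>Multiply the connection identity by \<open>mulmat z\<close> and take traces; cyclicity
  gathers the connection terms on both sides as traces that agree since y z = z y. The factor z
  serves two purposes: z = 1 shows that the trace commutes with d, and z = 1/y gives the logarithmic
  derivative of the norm.\<close>

lemma Tr_deriv_mult:
  assumes y: "y \<in> F" and z: "z \<in> F"
  shows "Tr (d y * z) + mat_trace (mulmat (z * y) * conn)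
    = mat_trace (map_mat d (mulmat y) * mulmat z) + mat_trace (mulmat (y * z) * conn)"
proof -
  note c = mulmat_carrier conn_carrier
  have cyc: "mulmat y * conn \<in> carrier_mat n n" and ccy: "conn * mulmat y \<in> carrier_mat n n"
    by (auto intro: mult_carrier_mat c)
  have "mat_trace ((mulmat (d y) + mulmat y * conn) * mulmat z)
      = mat_trace (mulmat (d y) * mulmat z) + mat_trace (mulmat y * conn * mulmat z)"
    unfolding add_mult_distrib_mat[OF c(1) cyc c(1)]
    by (rule mat_trace_add[OF mult_carrier_mat[OF c(1) c(1)] mult_carrier_mat[OF cyc c(1)]])
  also have "mulmat (d y) * mulmat z = mulmat (d y * z)"
    by (simp add: mulmat_mult Fd y z)
  also have "mat_trace (mulmat y * conn * mulmat z) = mat_trace (mulmat z * (mulmat y * conn))"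
    by (rule mat_trace_mult_commute[OF cyc c(1)])
  also have "mulmat z * (mulmat y * conn) = mulmat (z * y) * conn"
    by (simp add: mulmat_mult y z assoc_mult_mat[OF c(1) c(1) c(2)])
  finally have 1: "mat_trace ((mulmat (d y) + mulmat y * conn) * mulmat z)
      = Tr (d y * z) + mat_trace (mulmat (z * y) * conn)" by (simp add: Tr_def)
  have cd: "map_mat d (mulmat y) \<in> carrier_mat n n" by (simp add: mulmat_def)
  have "mat_trace ((map_mat d (mulmat y) + conn * mulmat y) * mulmat z)
      = mat_trace (map_mat d (mulmat y) * mulmat z) + mat_trace (conn * mulmat y * mulmat z)"
    unfolding add_mult_distrib_mat[OF cd ccy c(1)]
    by (rule mat_trace_add[OF mult_carrier_mat[OF cd c(1)] mult_carrier_mat[OF ccy c(1)]])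
  also have "conn * mulmat y * mulmat z = conn * mulmat (y * z)"
    by (simp add: mulmat_mult y z assoc_mult_mat[OF c(2) c(1) c(1)])
  also have "mat_trace (conn * mulmat (y * z)) = mat_trace (mulmat (y * z) * conn)"
    by (rule mat_trace_mult_commute[OF c(2) c(1)])
  finally show ?thesis using 1 mulmat_deriv[OF y] by simp
qed

lemma Tr_deriv: "y \<in> F \<Longrightarrow> Tr (d y) = d (Tr y)"
  using Tr_deriv_mult[of y 1] subfield_1[OF F]
  by (simp add: mulmat_1 right_mult_one_mat[of _ n n] mat_trace_def Tr_def derivation_sum[OF d])
     (simp add: mulmat_def)

text \<open>N is the norm of u, and Jacobi's formula identifies its logarithmic derivative with the
  trace of d u / u.\<close>

lemma Tr_logderiv:
  assumes u: "u \<in> F" "u \<noteq> 0"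
  obtains N where "N \<in> L" "N \<noteq> 0" "Tr (d u / u) = d N / N"
proof -
  note c = mulmat_carrier
  define N where "N = det (mulmat u)"
  have iF: "inverse u \<in> F" by (intro subfield_inverse F u)
  have inv: "mulmat u * mulmat (inverse u) = 1\<^sub>m n"
    using u iF by (simp flip: mulmat_mult mulmat_1)
  have "N * det (mulmat (inverse u)) = 1"
    unfolding N_def by (subst det_mult[OF c c, symmetric]) (simp add: inv)
  then have N0: "N \<noteq> 0" by auto
  have entry: "mulmat u $$ (i, k) \<in> L" if "i < n" "k < n" for i k
    using that u by (simp add: mulmat_def co_L subfield_mult F powF)
  have "N \<in> L" unfolding N_def det_def'[OF c]
  proof (intro subfield_sum[OF L] subfield_mult[OF L] subfield_prod[OF L])
    fix p i assume p: "p \<in> {p. p permutes {0..<n}}"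
    show "signof p \<in> L" using L by (simp add: sign_def subfield_1 subfield_uminus)
    assume "i \<in> {0..<n}"
    then show "mulmat u $$ (i, p i) \<in> L" using p permutes_in_image[of p] by (intro entry) auto
  qed
  \<comment> \<open>The adjugate is the determinant times the inverse matrix, and the inverse matrix
    represents 1/u.\<close>
  have "adj_mat (mulmat u) = adj_mat (mulmat u) * (mulmat u * mulmat (inverse u))"
    by (simp only: inv right_mult_one_mat[OF adj_mat(1)[OF c]])
  also have "\<dots> = (adj_mat (mulmat u) * mulmat u) * mulmat (inverse u)"
    by (rule assoc_mult_mat[OF adj_mat(1)[OF c] c c, symmetric])
  also have "\<dots> = N \<cdot>\<^sub>m mulmat (inverse u)"
    unfolding adj_mat(3)[OF c] N_def[symmetric]
    by (simp add: mult_smult_assoc_mat[OF one_carrier_mat c] left_mult_one_mat[OF c])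
  finally have adj: "adj_mat (mulmat u) = N \<cdot>\<^sub>m mulmat (inverse u)" .
  have cd: "map_mat d (mulmat u) \<in> carrier_mat n n" by (simp add: mulmat_def)
  have "d N = mat_trace (map_mat d (mulmat u) * adj_mat (mulmat u))"
    unfolding N_def by (rule derivation_det[OF d c])
  also have "\<dots> = N * mat_trace (map_mat d (mulmat u) * mulmat (inverse u))"
    unfolding adj mult_smult_distrib[OF cd c]
    by (rule mat_trace_smult[OF mult_carrier_mat[OF cd c]])
  also have "mat_trace (map_mat d (mulmat u) * mulmat (inverse u)) = Tr (d u / u)"
    using Tr_deriv_mult[OF u(1) iF] by (simp add: divide_inverse mult.commute[of u])
  finally show thesis using N0 \<open>N \<in> L\<close> that by (simp add: field_simps)
qed

text \<open>Membership in L(t) is carried through the induction because additivity of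
  \<open>Tr\<close> holds only there.\<close>

lemma log_forms_Tr:
  assumes "l \<in> log_forms d F"
  shows "l \<in> F \<and> Tr l \<in> log_forms d L"
  using assms
proof induction
  case log_forms_0
  have "Tr 0 = 0" using Tr_base[of 0] subfield_0[OF L] by simp
  then show ?case by (simp add: subfield_0[OF F] log_forms.log_forms_0)
next
  case (log_forms_step l c u)
  obtain N where N: "N \<in> L" "N \<noteq> 0" "Tr (d u / u) = d N / N"
    using Tr_logderiv log_forms_step.hyps by blast
  have c: "c \<in> L" using const log_forms_step.hyps by auto
  have uF: "d u / u \<in> F" using log_forms_step.hyps by (intro subfield_divide F Fd)
  then have cu: "c * (d u / u) \<in> F" by (rule subfield_mult[OF F LF[OF c]])
  have "Tr (l + c * (d u / u)) = Tr l + c * (d N / N)"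
    using log_forms_step.IH cu uF c by (simp add: Tr_add Tr_cmult del: times_divide_eq_right flip: N(3))
  moreover have "Tr l + c * (d N / N) \<in> log_forms d L"
    using log_forms_step N by (intro log_forms.log_forms_step) simp_all
  ultimately show ?case using log_forms_step.IH cu by (simp only: subfield_add[OF F] simp_thms)
qed

text \<open>Averaging: apply the trace to h = d v + l and divide by n, which is invertible in
  characteristic 0. The trace sends the derivative to a derivative and logarithmic terms to
  logarithmic derivatives of norms.\<close>

lemma descent_algebraic:
  assumes h: "h \<in> L" "h \<in> liouville_forms d F"
  shows "h \<in> liouville_forms d L"
proof -
  from h(2) obtain v l where vl: "v \<in> F" "l \<in> log_forms d F" "h = d v + l"
    unfolding liouville_forms_def by blast
  define k where "k = inverse (of_nat n :: 'b)"
  have k: "k \<in> constants d" "k * of_nat n = 1"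
    using char0[OF n_pos] constants_divide[OF d constants_1[OF d] constants_of_nat[OF d], of n]
    by (simp_all add: k_def divide_inverse)
  have "of_nat n * h = Tr (d v + l)" using h(1) vl(3) by (simp add: Tr_base)
  also have "\<dots> = d (Tr v) + Tr l"
    using vl log_forms_Tr by (simp add: Tr_add Fd Tr_deriv)
  finally have "k * (of_nat n * h) = d (k * Tr v) + k * Tr l"
    by (simp add: derivation_cmult[OF d k(1)] algebra_simps)
  then have "h = d (k * Tr v) + k * Tr l" using k(2) by (simp flip: mult.assoc)
  moreover have "k * Tr v \<in> L" using k const Tr_L[OF vl(1)] by (intro subfield_mult L) auto
  moreover have "k * Tr l \<in> log_forms d L"
    using log_forms_Tr[OF vl(2)] by (intro log_forms_cmult d k) simp
  ultimately show ?thesis unfolding liouville_forms_def by blast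
qed

end

section \<open>Liouville's theorem\<close>

text \<open>t is elementary over M while the descent goes to the larger field L. An exponential or
  logarithm over M may become algebraic over L, so the case distinction is made over L.\<close>

lemma elementary_descent:
  fixes d :: "'b::field \<Rightarrow> 'b"
  assumes char0: "\<And>n. 0 < n \<Longrightarrow> of_nat n \<noteq> (0::'b)"
    and d: "derivation d" and L: "subfield L" and const: "constants d \<subseteq> L"
    and Ld: "\<And>a. a \<in> L \<Longrightarrow> d a \<in> L"
    and M: "M \<subseteq> L" and el: "elementary_over d M t"
  shows "d t \<in> fracs L t \<and> (\<forall>h\<in>L. h \<in> liouville_forms d (fracs L t) \<longrightarrow> h \<in> liouville_forms d L)"
proof (cases "transcendental_over L t")
  case True
  note F = subfield_fracs[OF L, of t]
  have LF: "a \<in> fracs L t" if "a \<in> L" for a using fracs_superset[OF L] that by blast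
  have "\<not> (\<exists>p::'b poly. p \<noteq> 0 \<and> (\<forall>i. coeff p i \<in> M) \<and> poly p t = 0)"
    using True M by (auto simp: transcendental_over_def polys_over_def)
  then consider a where "a \<in> M" "t \<noteq> 0" "d t / t = d a" | a where "a \<in> M" "a \<noteq> 0" "d t = d a / a"
    using el unfolding elementary_over_def by blast
  then show ?thesis
  proof cases
    case 1
    then have a: "a \<in> L" "d t = d a * t" using M by (auto simp: field_simps)
    interpret transcendental_step d L t 0 "d a"
      by unfold_locales (use assms a True in \<open>auto intro: subfield_0\<close>)
    have "d t \<in> fracs L t"
      unfolding a(2) by (rule subfield_mult[OF F LF[OF Ld[OF a(1)]] fracs_generator[OF L]])
    then show ?thesis using a descent_exp[of _ a] by blast
  next
    case 2
    then have a: "a \<in> L" "d t = d a / a" using M by auto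
    interpret transcendental_step d L t "d a / a" 0
      by unfold_locales (use assms a True in \<open>auto intro: subfield_0 subfield_divide\<close>)
    have "d t \<in> fracs L t"
      unfolding a(2) by (rule subfield_divide[OF F LF[OF Ld[OF a(1)]] LF[OF a(1)]])
    then show ?thesis using a 2 descent_log[of _ a] by blast
  qed
next
  case False
  interpret algebraic_step d L t
    by unfold_locales (use assms False in auto)
  show ?thesis using dt descent_algebraic by blast
qed

text \<open>The tower E over K is rebuilt on top of L, giving the compositum M of L and E. This is
  what permits enlarging the base by constants although E is elementary only over K.\<close>

lemma liouville:
  fixes d :: "'b::field \<Rightarrow> 'b"
  assumes char0: "\<And>n. 0 < n \<Longrightarrow> of_nat n \<noteq> (0::'b)"
    and d: "derivation d" and L: "subfield L" and const: "constants d \<subseteq> L"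
    and Ld: "\<And>a. a \<in> L \<Longrightarrow> d a \<in> L"
    and K: "K \<subseteq> L" and E: "elementary_ext d K E"
  obtains M where "subfield M" "\<And>a. a \<in> M \<Longrightarrow> d a \<in> M" "L \<subseteq> M" "E \<subseteq> M"
    "\<And>h. h \<in> L \<Longrightarrow> h \<in> liouville_forms d M \<Longrightarrow> h \<in> liouville_forms d L"
proof -
  from E obtain ts where ts: "E = gen_field (K \<union> set ts)"
    "\<And>i. i < length ts \<Longrightarrow> elementary_over d (gen_field (K \<union> set (take i ts))) (ts ! i)"
    unfolding elementary_ext_def by blast
  \<comment> \<open>Closure under d belongs to the induction, since the next descent step assumes it
    of its base field.\<close>
  have "\<exists>M. subfield M \<and> (\<forall>a\<in>M. d a \<in> M) \<and> L \<subseteq> M \<and> set (take i ts) \<subseteq> M \<and>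
      (\<forall>h\<in>L. h \<in> liouville_forms d M \<longrightarrow> h \<in> liouville_forms d L)" if "i \<le> length ts" for i
    using that
  proof (induction i)
    case 0
    then show ?case using L Ld by (intro exI[of _ L]) auto
  next
    case (Suc i)
    then obtain M where M: "subfield M" "\<And>a. a \<in> M \<Longrightarrow> d a \<in> M" "L \<subseteq> M" "set (take i ts) \<subseteq> M"
      "\<And>h. h \<in> L \<Longrightarrow> h \<in> liouville_forms d M \<Longrightarrow> h \<in> liouville_forms d L" by auto
    have "gen_field (K \<union> set (take i ts)) \<subseteq> M" using M K by (intro gen_field_least) auto
    moreover have "elementary_over d (gen_field (K \<union> set (take i ts))) (ts ! i)"
      using Suc.prems by (intro ts) simp
    ultimately have *: "d (ts ! i) \<in> fracs M (ts ! i)"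
        "\<And>h. h \<in> M \<Longrightarrow> h \<in> liouville_forms d (fracs M (ts ! i)) \<Longrightarrow> h \<in> liouville_forms d M"
      using elementary_descent[OF char0 d M(1) _ M(2)] const M(3) by blast+
    have "set (take (Suc i) ts) = insert (ts ! i) (set (take i ts))"
      using Suc.prems by (simp add: take_Suc_conv_app_nth)
    moreover have "M \<subseteq> fracs M (ts ! i)" by (rule fracs_superset[OF M(1)])
    ultimately have "L \<subseteq> fracs M (ts ! i)" "set (take (Suc i) ts) \<subseteq> fracs M (ts ! i)"
      using M(3,4) fracs_generator[OF M(1)] by auto
    moreover have "h \<in> liouville_forms d L" if "h \<in> L" "h \<in> liouville_forms d (fracs M (ts ! i))" for h
      using M(3,5) *(2) that by blast
    ultimately show ?case using subfield_fracs[OF M(1)] fracs_closed[OF M(1) d M(2) *(1)]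
      by (intro exI[of _ "fracs M (ts ! i)"]) simp
  qed
  from this[of "length ts"] obtain M where M: "subfield M" "\<And>a. a \<in> M \<Longrightarrow> d a \<in> M" "L \<subseteq> M"
    "set ts \<subseteq> M" "\<And>h. h \<in> L \<Longrightarrow> h \<in> liouville_forms d M \<Longrightarrow> h \<in> liouville_forms d L"
    by auto
  moreover have "E \<subseteq> M" unfolding ts(1) using M K by (intro gen_field_least) auto
  ultimately show thesis using that by blast
qed

section \<open>Adjoining constants\<close>

text \<open>Constants of the ambient field that are dependent over K are already dependent over the
  constants of K. Scale a relation so that one coefficient is 1 and differentiate: either every
  coefficient was constant, or a nontrivial relation with fewer nonzero coefficients arises.\<close>

lemma linear_dependence_over_constants:
  fixes d :: "'b::field \<Rightarrow> 'b"
  assumes d: "derivation d" and K: "subfield K" and Kd: "\<And>a. a \<in> K \<Longrightarrow> d a \<in> K"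
    and I: "finite I" and e: "\<And>i. i \<in> I \<Longrightarrow> e i \<in> constants d"
    and y: "\<And>i. i \<in> I \<Longrightarrow> y i \<in> K" and sum: "(\<Sum>i\<in>I. e i * y i) = 0" and ex: "\<exists>i\<in>I. y i \<noteq> 0"
  shows "\<exists>c. (\<forall>i\<in>I. c i \<in> K \<inter> constants d) \<and> (\<exists>i\<in>I. c i \<noteq> 0) \<and> (\<Sum>i\<in>I. e i * c i) = 0"
  using y sum ex
proof (induction "card {i \<in> I. y i \<noteq> 0}" arbitrary: y rule: less_induct)
  case less
  then obtain k where k: "k \<in> I" "y k \<noteq> 0" by blast
  define c where "c i = y i / y k" for i
  define z where "z i = d (c i)" for i
  have cK: "c i \<in> K" if "i \<in> I" for i
    unfolding c_def using that k less.prems by (intro subfield_divide[OF K])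
  have csum: "(\<Sum>i\<in>I. e i * c i) = 0"
    using less.prems(2) by (simp add: c_def flip: sum_divide_distrib)
  show ?case
  proof (cases "\<exists>i\<in>I. z i \<noteq> 0")
    case False
    moreover have "c k = 1" using k by (simp add: c_def)
    then have "\<exists>i\<in>I. c i \<noteq> 0" using k(1) by (intro bexI[of _ k]) simp_all
    ultimately show ?thesis using cK csum
      by (intro exI[of _ c]) (auto simp: z_def constants_def)
  next
    case True
    have zk: "z k = 0" using k by (simp add: z_def c_def derivation_1[OF d])
    have "{i \<in> I. z i \<noteq> 0} \<subseteq> {i \<in> I. y i \<noteq> 0}"
      by (auto simp: z_def c_def derivation_0[OF d])
    moreover have "k \<notin> {i \<in> I. z i \<noteq> 0}" "k \<in> {i \<in> I. y i \<noteq> 0}" using k zk by auto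
    ultimately have "{i \<in> I. z i \<noteq> 0} \<subset> {i \<in> I. y i \<noteq> 0}" by blast
    then have "card {i \<in> I. z i \<noteq> 0} < card {i \<in> I. y i \<noteq> 0}"
      using I by (intro psubset_card_mono) auto
    moreover have "z i \<in> K" if "i \<in> I" for i unfolding z_def using cK that by (intro Kd)
    moreover have "(\<Sum>i\<in>I. e i * z i) = d (\<Sum>i\<in>I. e i * c i)"
      unfolding derivation_sum[OF d] using e
      by (intro sum.cong) (auto simp: z_def derivation_cmult[OF d])
    then have "(\<Sum>i\<in>I. e i * z i) = 0" by (simp add: csum derivation_0[OF d])
    ultimately show ?thesis using less.hyps True by blast
  qed
qed

section \<open>Transcendence over the field enlarged by constants\<close>

locale constant_extension =
  fixes d :: "'b::field \<Rightarrow> 'b" and F K :: "'b set" and t :: 'b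
  assumes d: "derivation d" and F: "subfield F" and K: "subfield K"
    and Kd: "\<And>a. a \<in> K \<Longrightarrow> d a \<in> K"
    and FK: "F \<subseteq> K" and tK: "t \<in> K" and trans: "transcendental_over F t"
    and const: "K \<inter> constants d \<subseteq> F"
begin

lemma poly_in_K: "q \<in> polys_over F \<Longrightarrow> poly q t \<in> K"
  unfolding poly_altdef using FK tK
  by (intro subfield_sum[OF K] subfield_mult[OF K] subfield_power[OF K]) (auto dest: polys_over_coeff)

text \<open>Induction on the number of terms. A nonzero value makes the e i dependent over constants
  of K, which lie in F, so one of them can be eliminated and its term absorbed into the other q i.
  If all values vanish, transcendence over F gives q i = 0.\<close>

lemma sum_eq_0_if_value_eq_0:
  assumes "finite I" "\<And>i. i \<in> I \<Longrightarrow> e i \<in> constants d" "\<And>i. i \<in> I \<Longrightarrow> q i \<in> polys_over F"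
    and "(\<Sum>i\<in>I. e i * poly (q i) t) = 0"
  shows "(\<Sum>i\<in>I. Polynomial.smult (e i) (q i)) = 0"
  using assms
proof (induction "card I" arbitrary: I q rule: less_induct)
  case less
  show ?case
  proof (cases "\<exists>i\<in>I. poly (q i) t \<noteq> 0")
    case False
    then have "q i = 0" if "i \<in> I" for i
      using that less.prems(3) trans by (auto simp: transcendental_over_def)
    then show ?thesis by simp
  next
    case True
    with linear_dependence_over_constants[OF d K Kd less.prems(1,2) _ less.prems(4)] poly_in_K
      less.prems(3)
    obtain c where c: "\<forall>i\<in>I. c i \<in> K \<inter> constants d" "\<exists>i\<in>I. c i \<noteq> 0" "(\<Sum>i\<in>I. e i * c i) = 0"
      by blast
    then obtain k where k: "k \<in> I" "c k \<noteq> 0" by blast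
    define b where "b i = c i / c k" for i
    have bF: "b i \<in> F" if "i \<in> I" for i
      using c(1) const k that unfolding b_def by (intro subfield_divide[OF F]) auto
    have "(\<Sum>i\<in>I. e i * b i) = 0" using c(3) by (simp add: b_def flip: sum_divide_distrib)
    \<comment> \<open>Here b k = 1, so the relation can be solved for e k.\<close>
    then have ek: "e k = - (\<Sum>i\<in>I - {k}. e i * b i)"
      using k less.prems(1) by (simp add: sum.remove[of I k] b_def eq_neg_iff_add_eq_0)
    define r where "r i = q i - Polynomial.smult (b i) (q k)" for i
    have r: "r i \<in> polys_over F" if "i \<in> I - {k}" for i
      unfolding r_def using that k less.prems bF
      by (intro polys_over_diff[OF F] polys_over_smult[OF F]) auto
    have "(\<Sum>i\<in>I. e i * poly (q i) t) = e k * poly (q k) t + (\<Sum>i\<in>I - {k}. e i * poly (q i) t)"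
      using k less.prems(1) by (simp add: sum.remove)
    also have "\<dots> = (\<Sum>i\<in>I - {k}. e i * poly (r i) t)"
      unfolding ek by (simp add: r_def algebra_simps sum_subtractf sum_distrib_left)
    finally have "(\<Sum>i\<in>I - {k}. e i * poly (r i) t) = 0" using less.prems(4) by simp
    moreover have "card (I - {k}) < card I" using k less.prems(1) by (intro card_Diff1_less)
    ultimately have 0: "(\<Sum>i\<in>I - {k}. Polynomial.smult (e i) (r i)) = 0"
      using less.hyps[of "I - {k}" r] less.prems r by auto
    have "(\<Sum>i\<in>I. Polynomial.smult (e i) (q i))
        = Polynomial.smult (e k) (q k) + (\<Sum>i\<in>I - {k}. Polynomial.smult (e i) (q i))"
      using k less.prems(1) by (simp add: sum.remove)
    also have "\<dots> = (\<Sum>i\<in>I - {k}. Polynomial.smult (e i) (r i))"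
      unfolding ek by (simp add: r_def smult_diff_right sum_subtractf smult_sum)
    finally show ?thesis using 0 by simp
  qed
qed

text \<open>The ring generated by C and F[X], where C is the field of all constants; additive
  generators suffice because constants and F[X] are each closed under products.\<close>

inductive_set cspan :: "'b poly set" where
  cspan_0: "0 \<in> cspan"
| cspan_step: "s \<in> cspan \<Longrightarrow> e \<in> constants d \<Longrightarrow> q \<in> polys_over F \<Longrightarrow>
    s + Polynomial.smult e q \<in> cspan"

lemma cspan_sum:
  assumes "s \<in> cspan"
  shows "\<exists>n e q. (\<forall>i<n. e i \<in> constants d \<and> q i \<in> polys_over F) \<and>
    s = (\<Sum>i<n::nat. Polynomial.smult (e i) (q i))"
  using assms
proof induction
  case cspan_0
  then show ?case by (intro exI[of _ 0]) auto
next
  case (cspan_step s e q)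
  then obtain n e' q' where "\<forall>i<n. e' i \<in> constants d \<and> q' i \<in> polys_over F"
    "s = (\<Sum>i<n::nat. Polynomial.smult (e' i) (q' i))" by blast
  then show ?case using cspan_step.hyps
    by (intro exI[of _ "Suc n"] exI[of _ "e'(n := e)"] exI[of _ "q'(n := q)"]) (auto simp: less_Suc_eq)
qed

lemma cspan_eq_0: "s \<in> cspan \<Longrightarrow> poly s t = 0 \<Longrightarrow> s = 0"
proof -
  assume "s \<in> cspan" "poly s t = 0"
  moreover from this obtain n e q where "\<forall>i<n. e i \<in> constants d \<and> q i \<in> polys_over F"
    "s = (\<Sum>i<n::nat. Polynomial.smult (e i) (q i))" using cspan_sum by blast
  ultimately show ?thesis
    using sum_eq_0_if_value_eq_0[of "{..<n}" e q] by (simp add: poly_sum)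
qed

lemma cspan_add: "s \<in> cspan \<Longrightarrow> r \<in> cspan \<Longrightarrow> r + s \<in> cspan"
  by (induction s rule: cspan.induct) (auto intro: cspan.intros simp flip: add.assoc)

lemma cspan_mult_1:
  assumes "s \<in> cspan" "e \<in> constants d" "q \<in> polys_over F"
  shows "s * Polynomial.smult e q \<in> cspan"
  using assms(1)
proof induction
  case (cspan_step s e' q')
  then have "s * Polynomial.smult e q + Polynomial.smult (e' * e) (q' * q) \<in> cspan"
    by (intro cspan.cspan_step constants_mult[OF d] polys_over_mult[OF F] assms)
  then show ?case by (simp add: algebra_simps)
qed (simp add: cspan.intros)

lemma cspan_mult:
  assumes "s \<in> cspan" "r \<in> cspan"
  shows "r * s \<in> cspan"
  using assms(1)
proof induction
  case (cspan_step s e q)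
  then have "r * s + r * Polynomial.smult e q \<in> cspan"
    by (intro cspan_add cspan_mult_1 assms(2))
  then show ?case by (simp only: distrib_left)
qed (simp add: cspan.intros)

lemma cspan_poly: "q \<in> polys_over F \<Longrightarrow> q \<in> cspan"
  using cspan_step[OF cspan_0 constants_1[OF d]] by simp

lemma cspan_constant: "e \<in> constants d \<Longrightarrow> [:e:] \<in> cspan"
  using cspan_step[OF cspan_0 _ polys_over_1[OF F]] by (simp add: one_pCons)

lemma cspan_uminus: "s \<in> cspan \<Longrightarrow> - s \<in> cspan"
  using cspan_mult[of s "[:- 1:]"] cspan_poly[of "[:- 1:]"] F
  by (simp add: polys_over_pCons polys_over_0 subfield_uminus subfield_1)

text \<open>F(C) is the fraction field of the ring generated by F and C, so the coefficients of Q
  have a common denominator in that ring.\<close>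

lemma clear_denominators:
  assumes "Q \<in> polys_over (gen_field (F \<union> constants d))"
  obtains b where "b \<noteq> 0" "Polynomial.smult b Q \<in> cspan"
proof -
  \<comment> \<open>Elements of that ring are encoded as constant polynomials in
    \<open>cspan\<close>.\<close>
  define R where "R = {a / b |a b. [:a:] \<in> cspan \<and> [:b:] \<in> cspan \<and> b \<noteq> 0}"
  have RI: "a / b \<in> R" if "[:a:] \<in> cspan" "[:b:] \<in> cspan" "b \<noteq> 0" for a b
    using that unfolding R_def by blast
  have one: "[:1:] \<in> cspan" using cspan_poly[OF polys_over_1[OF F]] by (simp add: one_pCons)
  have emb: "a \<in> R" if "[:a:] \<in> cspan" for a using RI[OF that one] by simp
  have arith: "a + b \<in> R \<and> a * b \<in> R" if ab: "a \<in> R" "b \<in> R" for a b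
  proof -
    from ab obtain a1 a2 b1 b2 where *: "a = a1 / a2" "b = b1 / b2" "a2 \<noteq> 0" "b2 \<noteq> 0"
      "[:a1:] \<in> cspan" "[:a2:] \<in> cspan" "[:b1:] \<in> cspan" "[:b2:] \<in> cspan"
      unfolding R_def by blast
    have m: "[:u * v:] \<in> cspan" if "[:u:] \<in> cspan" "[:v:] \<in> cspan" for u v
      using cspan_mult[OF that(2,1)] by (simp add: mult.commute)
    have "[:a1 * b2 + b1 * a2:] \<in> cspan"
      using cspan_add[OF m[OF *(7,6)] m[OF *(5,8)]] by simp
    then show ?thesis
      using RI[of "a1 * b2 + b1 * a2" "a2 * b2"] RI[of "a1 * b1" "a2 * b2"] m *
      by (simp add: add_frac_eq)
  qed
  have "- a \<in> R \<and> inverse a \<in> R" if "a \<in> R" for a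
  proof -
    from that obtain a1 a2 where *: "a = a1 / a2" "a2 \<noteq> 0" "[:a1:] \<in> cspan" "[:a2:] \<in> cspan"
      unfolding R_def by blast
    then show ?thesis using RI[of "- a1" a2] cspan_uminus[of "[:a1:]"] RI[of a2 a1] emb[of 0] cspan_0
      by (cases "a1 = 0") auto
  qed
  then have "subfield R"
    using arith emb[of 0] emb[of 1] one cspan_0 by (simp add: subfield_def)
  moreover have "F \<union> constants d \<subseteq> R"
    using emb cspan_constant cspan_poly F by (auto simp: polys_over_pCons polys_over_0)
  ultimately have "gen_field (F \<union> constants d) \<subseteq> R" by (rule gen_field_least)
  then have "Q \<in> polys_over R" using assms polys_over_mono by blast
  \<comment> \<open>The denominator itself is required to lie in \<open>cspan\<close>, because
    adding a coefficient multiplies that coefficient's numerator by it.\<close>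
  then have "\<exists>b. b \<noteq> 0 \<and> [:b:] \<in> cspan \<and> Polynomial.smult b Q \<in> cspan"
  proof (induction Q)
    case 0
    then show ?case using one cspan_0 by (intro exI[of _ 1]) auto
  next
    case (pCons a Q)
    have "a \<in> R" "Q \<in> polys_over R"
      using pCons.prems polys_over_coeff[OF pCons.prems, of 0]
        polys_over_coeff[OF pCons.prems, of "Suc _"] by (auto simp: polys_over_def)
    then obtain b a1 a2 where *: "b \<noteq> 0" "[:b:] \<in> cspan" "Polynomial.smult b Q \<in> cspan"
      "a = a1 / a2" "[:a1:] \<in> cspan" "[:a2:] \<in> cspan" "a2 \<noteq> 0"
      using pCons.IH unfolding R_def by blast
    have X: "[:0, 1:] \<in> cspan"
      using F by (intro cspan_poly polys_over_pCons polys_over_0 subfield_0 subfield_1)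
    have "[:a1:] * [:b:] + [:0, 1:] * ([:a2:] * Polynomial.smult b Q) \<in> cspan"
      by (intro cspan_add cspan_mult X *)
    also have "[:a1:] * [:b:] + [:0, 1:] * ([:a2:] * Polynomial.smult b Q)
        = Polynomial.smult (a2 * b) (pCons a Q)" using * by (simp add: mult.commute)
    finally show ?case using * cspan_mult[OF *(2,6)] by (intro exI[of _ "a2 * b"]) (auto simp: mult.commute)
  qed
  then show thesis using that by blast
qed

lemma transcendental_constant_extension:
  "transcendental_over (gen_field (F \<union> constants d)) t"
  unfolding transcendental_over_def
proof (intro ballI impI)
  fix Q assume Q: "Q \<in> polys_over (gen_field (F \<union> constants d))" "poly Q t = 0"
  obtain b where b: "b \<noteq> 0" "Polynomial.smult b Q \<in> cspan" using clear_denominators[OF Q(1)] .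
  have "Polynomial.smult b Q = 0" using b Q by (intro cspan_eq_0) auto
  then show "Q = 0" using b by simp
qed

end

section \<open>Residues in differential valuation rings\<close>

lemma logderiv_power:
  fixes d :: "'b::field \<Rightarrow> 'b"
  assumes d: "derivation d" and p: "p \<noteq> 0"
  shows "d (p ^ n) / p ^ n = of_nat n * (d p / p)"
proof -
  have "d (p ^ n) * p = of_nat n * p ^ n * d p"
    by (induction n) (simp_all add: derivation_1[OF d] derivation_mult[OF d] algebra_simps)
  then show ?thesis using p by (simp add: field_simps)
qed

text \<open>The quotient rule with the pole cleared: modulo p the right-hand side is -n w d p, the
  leading coefficient of a pole of order n + 1.\<close>

lemma derivation_div_power:
  fixes d :: "'b::field \<Rightarrow> 'b"
  assumes d: "derivation d" and p: "p \<noteq> 0"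
  shows "p ^ Suc n * d (w / p ^ n) = p * d w - of_nat n * w * d p"
proof -
  have "d (w / p ^ n) = (d w - w * (d (p ^ n) / p ^ n)) / p ^ n"
    using p by (simp add: derivation_divide[OF d] field_simps power2_eq_square)
  then show ?thesis unfolding logderiv_power[OF d p] using p by (simp add: field_simps)
qed

text \<open>R is a discrete valuation ring of K with uniformiser p, stable under d. Normality of p
  is the assumption that d p is a unit. \<open>decomp\<close> expresses an integer exponent by two
  alternatives with natural exponents.\<close>

locale differential_valuation_ring =
  fixes d :: "'b::field \<Rightarrow> 'b" and F R K :: "'b set" and p x :: 'b
  assumes char0: "\<And>n. 0 < n \<Longrightarrow> of_nat n \<noteq> (0::'b)"
    and d: "derivation d" and F: "subfield F" and K: "subfield K"
    and Kd: "\<And>a. a \<in> K \<Longrightarrow> d a \<in> K" and Rd: "\<And>a. a \<in> R \<Longrightarrow> d a \<in> R"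
    and FR: "F \<subseteq> R" and RK: "R \<subseteq> K"
    and R_add: "\<And>a b. a \<in> R \<Longrightarrow> b \<in> R \<Longrightarrow> a + b \<in> R"
    and R_mult: "\<And>a b. a \<in> R \<Longrightarrow> b \<in> R \<Longrightarrow> a * b \<in> R"
    and p: "p \<in> R" "p \<noteq> 0" "inverse p \<notin> R" "inverse (d p) \<in> R" "d p \<noteq> 0"
    and decomp: "\<And>u. u \<in> K \<Longrightarrow> u \<noteq> 0 \<Longrightarrow>
      \<exists>n w. w \<in> R \<and> inverse w \<in> R \<and> w \<noteq> 0 \<and> (u = p ^ n * w \<or> u = w / p ^ n)"
    and x: "x \<in> F" "d x = 1" and const: "constants d \<subseteq> F"
begin

lemma F_in_R: "a \<in> F \<Longrightarrow> a \<in> R"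
  using FR by blast

lemma R_in_K: "a \<in> R \<Longrightarrow> a \<in> K"
  using RK by blast

lemma R_minus: "a \<in> R \<Longrightarrow> - a \<in> R"
  using R_mult[OF F_in_R[OF subfield_uminus[OF F subfield_1[OF F]]], of a] by simp

lemma R_diff: "a \<in> R \<Longrightarrow> b \<in> R \<Longrightarrow> a - b \<in> R"
  using R_add[OF _ R_minus] by simp

lemma R_power: "a \<in> R \<Longrightarrow> a ^ n \<in> R"
  by (induction n) (auto intro: R_mult F_in_R subfield_1[OF F])

lemma R_inverse_of_nat: "inverse (of_nat n) \<in> R"
  by (intro F_in_R subfield_inverse[OF F] subfield_of_nat[OF F])

lemma p_in_K: "p \<in> K"
  by (intro R_in_K p)

text \<open>Being exact means being a derivative modulo elements without pole at p; residues are
  only considered up to this.\<close>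

definition exact :: "'b set" where
  "exact = {d v + r |v r. v \<in> K \<and> r \<in> R}"

lemma exactI: "v \<in> K \<Longrightarrow> r \<in> R \<Longrightarrow> h = d v + r \<Longrightarrow> h \<in> exact"
  unfolding exact_def by blast

lemma exact_deriv: "v \<in> K \<Longrightarrow> d v \<in> exact"
  by (rule exactI[of v 0]) (auto intro: F_in_R subfield_0[OF F])

lemma R_exact: "r \<in> R \<Longrightarrow> r \<in> exact"
  by (rule exactI[of 0 r]) (auto intro: subfield_0[OF K] simp: derivation_0[OF d])

lemma exact_add: "a \<in> exact \<Longrightarrow> b \<in> exact \<Longrightarrow> a + b \<in> exact"
proof -
  assume "a \<in> exact" "b \<in> exact"
  then obtain v r w s where "v \<in> K" "r \<in> R" "a = d v + r" "w \<in> K" "s \<in> R" "b = d w + s"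
    unfolding exact_def by blast
  then show ?thesis
    by (intro exactI[of "v + w" "r + s"]) (auto intro: subfield_add[OF K] R_add simp: derivation_add[OF d])
qed

lemma exact_cmult: "c \<in> constants d \<Longrightarrow> a \<in> exact \<Longrightarrow> c * a \<in> exact"
proof -
  assume c: "c \<in> constants d" and "a \<in> exact"
  then obtain v r where *: "v \<in> K" "r \<in> R" "a = d v + r" unfolding exact_def by blast
  have "c \<in> R" "c \<in> K" using c const F_in_R R_in_K by auto
  with * c show ?thesis
    by (intro exactI[of "c * v" "c * r"])
      (auto intro: subfield_mult[OF K] R_mult simp: derivation_cmult[OF d c] algebra_simps)
qed

lemma exact_minus: "a \<in> exact \<Longrightarrow> - a \<in> exact"
  using exact_cmult[OF constants_uminus[OF d constants_1[OF d]], of a] by simp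

lemma exact_diff: "a \<in> exact \<Longrightarrow> b \<in> exact \<Longrightarrow> a - b \<in> exact"
  using exact_add[OF _ exact_minus] by simp

text \<open>Differentiating a pole of order n > 0 gives a pole of order exactly n + 1, as n times a
  unit times d p is again a unit. A derivative therefore never has a simple pole.\<close>

lemma deriv_simple_pole_imp_R:
  assumes v: "v \<in> K" and dv: "p * d v \<in> R"
  shows "v \<in> R"
proof (cases "v = 0")
  case False
  from decomp[OF v False] obtain n w where w: "w \<in> R" "inverse w \<in> R" "w \<noteq> 0"
    "v = p ^ n * w \<or> v = w / p ^ n" by blast
  show ?thesis
  proof (cases "v = p ^ n * w \<or> n = 0")
    case True
    with w(4) have "v = p ^ n * w" by (elim disjE) simp_all
    then show ?thesis using R_mult[OF R_power[OF p(1)] w(1)] by simp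
  next
    case F: False
    then obtain m where n: "n = Suc m" by (cases n) auto
    have v: "v = w / p ^ n" using w F by auto
    define a where "a = d w - p ^ m * (p * d v)"
    have "a \<in> R" unfolding a_def by (rule R_diff[OF Rd[OF w(1)] R_mult[OF R_power[OF p(1)] dv]])
    \<comment> \<open>The left side is a unit, so this would make p invertible in R.\<close>
    have eq: "of_nat n * w * d p = p * a"
      using derivation_div_power[OF d p(2), of n w] by (simp add: a_def n v algebra_simps)
    moreover have nz: "of_nat n * w * d p \<noteq> 0" using char0[of n] w p n by simp
    ultimately have "inverse p = a * inverse (of_nat n * w * d p)" by (auto simp: field_simps)
    also have "\<dots> = a * (inverse (of_nat n) * inverse w * inverse (d p))" by (simp add: ac_simps)
    also have "\<dots> \<in> R"
      by (rule R_mult[OF \<open>a \<in> R\<close> R_mult[OF R_mult[OF R_inverse_of_nat w(2)] p(4)]])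
    finally have "inverse p \<in> R" .
    then show ?thesis using p by simp
  qed
qed (auto intro: F_in_R subfield_0[OF F])

lemma exact_simple_pole_imp_R:
  assumes s: "s \<in> exact" and ps: "p * s \<in> R"
  shows "s \<in> R"
proof -
  from s obtain v r where *: "v \<in> K" "r \<in> R" "s = d v + r" unfolding exact_def by blast
  have "p * s - p * r \<in> R" by (rule R_diff[OF ps R_mult[OF p(1) *(2)]])
  then have "p * d v \<in> R" by (simp add: * algebra_simps)
  then show ?thesis using * deriv_simple_pole_imp_R by (auto intro: R_add Rd)
qed

lemma residue_zero:
  assumes c: "c \<in> F" "c * (d p / p) \<in> exact"
  shows "c = 0"
proof (rule ccontr)
  assume c0: "c \<noteq> 0"
  have "p * (c * (d p / p)) \<in> R" using p c by (auto intro: R_mult Rd F_in_R)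
  then have "c * (d p / p) \<in> R" using exact_simple_pole_imp_R c by blast
  then have "inverse c * inverse (d p) * (c * (d p / p)) \<in> R"
    by (intro R_mult[OF R_mult[OF F_in_R[OF subfield_inverse[OF F c(1)]] p(4)]])
  also have "inverse c * inverse (d p) * (c * (d p / p)) = inverse p"
    using c0 p by (simp add: field_simps)
  finally show False using p by simp
qed

text \<open>Writing u as p^n or p^(-n) times a unit w, the logarithmic derivative of u is plus or
  minus n times d p / p, plus the pole-free d w / w.\<close>

lemma log_forms_residue:
  assumes "l \<in> log_forms d K"
  shows "\<exists>c\<in>constants d. l - c * (d p / p) \<in> R"
  using assms
proof induction
  case log_forms_0
  then show ?case
    by (intro bexI[of _ 0]) (auto intro: F_in_R subfield_0[OF F] constants_0[OF d])
next
  case (log_forms_step l c u)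
  then obtain b where b: "b \<in> constants d" "l - b * (d p / p) \<in> R" by blast
  from decomp[of u] log_forms_step obtain n w where w: "w \<in> R" "inverse w \<in> R" "w \<noteq> 0"
    "u = p ^ n * w \<or> u = w / p ^ n" by blast
  have dw: "d w / w \<in> R" unfolding divide_inverse by (intro R_mult Rd w)
  have pn: "p ^ n \<noteq> 0" using p by simp
  have "d u / u = of_nat n * (d p / p) + d w / w \<or> d u / u = - of_nat n * (d p / p) + d w / w"
    using w(4) logderiv_mult[OF d pn w(3)] logderiv_divide[OF d w(3) pn]
    unfolding logderiv_power[OF d p(2)] by auto
  then obtain k where k: "k \<in> constants d" "d u / u = k * (d p / p) + d w / w"
    using constants_of_nat[OF d, of n] constants_uminus[OF d] by metis
  have "l + c * (d u / u) - (b + c * k) * (d p / p) = (l - b * (d p / p)) + c * (d w / w)"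
    unfolding k by (simp add: algebra_simps)
  also have "\<dots> \<in> R"
  proof (rule R_add[OF b(2) R_mult[OF F_in_R dw]])
    show "c \<in> F" using const log_forms_step.hyps by blast
  qed
  finally show ?case using k b log_forms_step
    by (intro bexI[of _ "b + c * k"]) (auto intro: constants_add[OF d] constants_mult[OF d])
qed

text \<open>Besides leaving at most a simple pole, g has pole order one less than the bound for f;
  this drop drives the induction in \<open>residue_chain\<close>.\<close>

lemma hermite_reduction:
  "f \<in> K \<Longrightarrow> p ^ Suc m * f \<in> R \<Longrightarrow> \<exists>g\<in>K. p ^ m * g \<in> R \<and> p * (f - d g) \<in> R"
proof (induction m arbitrary: f)
  case 0
  then show ?case
    by (intro bexI[of _ 0]) (auto simp: derivation_0[OF d] intro: F_in_R subfield_0[OF F] subfield_0[OF K])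
next
  case (Suc m)
  define k where "k = Suc m"
  \<comment> \<open>Chosen so that -k w d p equals p^(k+1) f: then d (w / p^k) cancels the leading
    polar term of f.\<close>
  define w where "w = - (p ^ Suc k * f) * inverse (of_nat k) * inverse (d p)"
  have "p ^ Suc k * f \<in> R" using Suc.prems(2) by (simp only: k_def)
  then have w: "w \<in> R" unfolding w_def
    by (rule R_mult[OF R_mult[OF R_minus R_inverse_of_nat] p(4)])
  define g where "g = w / p ^ k"
  have g: "g \<in> K" unfolding g_def
    by (intro subfield_divide[OF K] subfield_power[OF K] p_in_K R_in_K w)
  have "of_nat k * w * d p = - (p ^ Suc k * f)"
    using char0[of k] p by (simp add: w_def k_def field_simps del: of_nat_Suc)
  then have "p ^ Suc k * d g = p * d w + p ^ Suc k * f"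
    unfolding g_def derivation_div_power[OF d p(2)] by simp
  then have "p * (p ^ k * (f - d g)) = p * (- d w)" by (simp add: algebra_simps)
  then have "p ^ Suc m * (f - d g) = - d w" using p(2) by (simp only: k_def mult_cancel_left simp_thms)
  then have "p ^ Suc m * (f - d g) \<in> R" using w by (simp only: R_minus Rd)
  moreover have "f - d g \<in> K" by (intro subfield_diff[OF K] Kd g Suc.prems)
  ultimately obtain h where h: "h \<in> K" "p ^ m * h \<in> R" "p * (f - d g - d h) \<in> R"
    using Suc.IH by blast
  have "p ^ Suc m * (g + h) = w + p * (p ^ m * h)"
    using p by (simp add: g_def k_def field_simps)
  also have "\<dots> \<in> R" by (rule R_add[OF w R_mult[OF p(1) h(2)]])
  finally show ?case using h g
    by (intro bexI[of _ "g + h"]) (auto simp: derivation_add[OF d] diff_diff_eq intro: subfield_add[OF K])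
qed

text \<open>The hypothesis on the derivatives of the residues \<open>c j\<close> of \<open>x\<^sup>j f\<close> generalises constancy of
  the \<open>c j\<close>.  It is inherited by the residues \<open>b j\<close> of \<open>x\<^sup>j g\<close>, where \<open>g\<close> is the exact part
  of \<open>f\<close>, and \<open>b 0\<close> is an antiderivative of \<open>c 0\<close>.\<close>

lemma residue_chain:
  assumes "f \<in> K" "p ^ m * f \<in> R"
    and "\<And>j. j \<le> m \<Longrightarrow> c j \<in> F" "\<And>j. j \<le> m \<Longrightarrow> x ^ j * f - c j * (d p / p) \<in> exact"
    and "\<And>j. j \<le> m \<Longrightarrow> d (c j) = x ^ j * d (c 0)"
  shows "c 0 = 0"
  using assms
proof (induction m arbitrary: f c)
  case 0
  have "f \<in> exact" using 0 by (intro R_exact) simp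
  moreover have "f - c 0 * (d p / p) \<in> exact" using "0.prems"(4)[of 0] by simp
  ultimately have "f - (f - c 0 * (d p / p)) \<in> exact" by (rule exact_diff)
  also have "f - (f - c 0 * (d p / p)) = c 0 * (d p / p)" by simp
  finally show ?case using "0.prems"(3)[of 0] by (intro residue_zero) auto
next
  case (Suc m)
  from hermite_reduction[OF Suc.prems(1,2)] obtain g where g: "g \<in> K" "p ^ m * g \<in> R"
    "p * (f - d g) \<in> R" by blast
  have c0: "c 0 \<in> F" using Suc.prems(3) by simp
  \<comment> \<open>\<open>s\<close> is exact with at most a simple pole, hence has none. So d g
    equals f - c 0 * (d p / p) up to R.\<close>
  define s where "s = f - d g - c 0 * (d p / p)"
  have "(f - c 0 * (d p / p)) - d g \<in> exact"
    by (rule exact_diff[OF _ exact_deriv[OF g(1)]]) (use Suc.prems(4)[of 0] in simp)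
  then have "s \<in> exact" by (simp add: s_def algebra_simps)
  moreover have "p * (f - d g) - c 0 * d p \<in> R"
    by (rule R_diff[OF g(3) R_mult[OF F_in_R[OF c0] Rd[OF p(1)]]])
  then have "p * s \<in> R" using p by (simp add: s_def algebra_simps)
  ultimately have s: "s \<in> R" by (rule exact_simple_pole_imp_R)
  \<comment> \<open>By parts, (j+1) x^j g is d (x^(j+1) g) - x^(j+1) d g. Substituting d g shows
    that, up to exact terms, x^j g is \<open>b j\<close> times d p / p.\<close>
  define b where "b j = inverse (of_nat (Suc j)) * (x ^ Suc j * c 0 - c (Suc j))" for j
  have inv: "inverse (of_nat (Suc j)) \<in> constants d" for j
    using constants_divide[OF d constants_1[OF d] constants_of_nat[OF d]] by (simp only: inverse_eq_divide)
  have nz: "of_nat (Suc j) \<noteq> (0::'b)" for j by (rule char0) simp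
  have dpow: "d (x ^ Suc j) = of_nat (Suc j) * x ^ j" for j
    using derivation_power_Suc[OF d, of x j] x by simp
  have db: "d (b j) = x ^ j * c 0" if "j \<le> m" for j
  proof -
    have "d (x ^ Suc j * c 0 - c (Suc j)) = of_nat (Suc j) * (x ^ j * c 0)"
      using Suc.prems(5)[of "Suc j"] that
      by (simp only: derivation_diff[OF d] derivation_mult[OF d, of "x ^ Suc j"] dpow) simp
    then show ?thesis unfolding b_def derivation_cmult[OF d inv]
      using nz[of j] by (simp add: field_simps del: of_nat_Suc)
  qed
  have "b 0 = 0"
  proof (rule Suc.IH[OF g(1,2)])
    fix j assume j: "j \<le> m"
    show "b j \<in> F" unfolding b_def using Suc.prems(3)[of "Suc j"] c0 x j
      by (intro subfield_mult[OF F] subfield_inverse[OF F] subfield_of_nat[OF F]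
        subfield_diff[OF F] subfield_power[OF F]) simp_all
    show "d (b j) = x ^ j * d (b 0)" using db[of j] db[of 0] j by simp
    have xj: "x ^ Suc j \<in> R" by (rule F_in_R[OF subfield_power[OF F x(1)]])
    have "x ^ Suc j * f - c (Suc j) * (d p / p) \<in> exact" using Suc.prems(4)[of "Suc j"] j by simp
    then have "d (x ^ Suc j * g) - (x ^ Suc j * f - c (Suc j) * (d p / p)) + x ^ Suc j * s \<in> exact"
      by (rule exact_add[OF exact_diff[OF exact_deriv[OF subfield_mult[OF K R_in_K[OF xj] g(1)]]]
        R_exact[OF R_mult[OF xj s]]])
    also have "d (x ^ Suc j * g) - (x ^ Suc j * f - c (Suc j) * (d p / p)) + x ^ Suc j * s
      = of_nat (Suc j) * (x ^ j * g) - (x ^ Suc j * c 0 - c (Suc j)) * (d p / p)"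
      unfolding derivation_mult[OF d, of "x ^ Suc j"] dpow s_def
      by (simp add: algebra_simps del: of_nat_Suc)
    finally have "inverse (of_nat (Suc j)) * (of_nat (Suc j) * (x ^ j * g)
        - (x ^ Suc j * c 0 - c (Suc j)) * (d p / p)) \<in> exact"
      by (intro exact_cmult inv)
    also have "inverse (of_nat (Suc j)) * (of_nat (Suc j) * (x ^ j * g)
        - (x ^ Suc j * c 0 - c (Suc j)) * (d p / p)) = x ^ j * g - b j * (d p / p)"
    proof -
      have "inverse k * (k * y - z * v) = y - inverse k * z * v" if "k \<noteq> 0" for k y z v :: 'b
        using that by (simp add: field_simps)
      then show ?thesis unfolding b_def using nz .
    qed
    finally show "x ^ j * g - b j * (d p / p) \<in> exact" .
  qed
  \<comment> \<open>At j = 0 the formula \<open>db\<close> reads d (b 0) = c 0.\<close>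
  then show ?case using db[of 0] by (simp add: derivation_0[OF d])
qed

text \<open>Liouville forms have constant residues, so both sides of the derivative hypothesis of
  \<open>residue_chain\<close> are 0. With c 0 = 0 the element f is exact, hence so is h, and a
  simple pole is then impossible.\<close>

lemma simple_part_vanishes:
  assumes f: "f \<in> K" "p ^ m * f \<in> R" and lf: "\<And>j. j \<le> m \<Longrightarrow> x ^ j * f \<in> liouville_forms d K"
    and g: "g \<in> K" and h: "p * h \<in> R" "f = d g + h"
  shows "h \<in> R"
proof -
  have "\<exists>c\<in>constants d. x ^ j * f - c * (d p / p) \<in> exact" if "j \<le> m" for j
  proof -
    from lf[OF that] obtain v l where vl: "v \<in> K" "l \<in> log_forms d K" "x ^ j * f = d v + l"
      unfolding liouville_forms_def by blast
    from log_forms_residue[OF vl(2)] obtain c where "c \<in> constants d" "l - c * (d p / p) \<in> R"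
      by blast
    then show ?thesis using vl by (intro bexI[of _ c] exactI[of v "l - c * (d p / p)"]) auto
  qed
  then obtain c where c: "\<And>j. j \<le> m \<Longrightarrow> c j \<in> constants d"
    "\<And>j. j \<le> m \<Longrightarrow> x ^ j * f - c j * (d p / p) \<in> exact" by metis
  have "c 0 = 0"
  proof (rule residue_chain[OF f])
    fix j assume "j \<le> m"
    then show "c j \<in> F" "x ^ j * f - c j * (d p / p) \<in> exact" "d (c j) = x ^ j * d (c 0)"
      using c const c(1)[of 0] by (auto simp: constants_def)
  qed
  then have "f \<in> exact" using c(2)[of 0] by simp
  then have "f - d g \<in> exact" by (intro exact_diff exact_deriv g)
  then have "h \<in> exact" by (simp add: h)
  then show ?thesis by (rule exact_simple_pole_imp_R[OF _ h(1)])
qed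

end

text \<open>For transcendental t and irreducible P, the localisation of F[t] at the prime P.\<close>

definition local_fracs :: "'b::field set \<Rightarrow> 'b poly \<Rightarrow> 'b \<Rightarrow> 'b set" where
  "local_fracs F P t =
    {poly A t / poly B t |A B. A \<in> polys_over F \<and> B \<in> polys_over F \<and> \<not> P dvd B}"

lemma local_fracsI: "A \<in> polys_over F \<Longrightarrow> B \<in> polys_over F \<Longrightarrow> \<not> P dvd B \<Longrightarrow>
    h = poly A t / poly B t \<Longrightarrow> h \<in> local_fracs F P t"
  unfolding local_fracs_def by blast

lemma local_fracsE:
  assumes "h \<in> local_fracs F P t"
  obtains A B where "A \<in> polys_over F" "B \<in> polys_over F" "\<not> P dvd B" "h = poly A t / poly B t"
  using assms unfolding local_fracs_def by blast

text \<open>By transcendence an identity in F(t) is an identity of polynomials, so divisibility by P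
  decides membership in the local ring. The derivative of P is a unit there because P does not
  divide it.\<close>

lemma differential_valuation_ring_local_fracs:
  fixes d :: "'b::field \<Rightarrow> 'b"
  assumes char0: "\<And>n. 0 < n \<Longrightarrow> of_nat n \<noteq> (0::'b)"
    and d: "derivation d" and F: "subfield F" and const: "constants d \<subseteq> F"
    and Fd: "\<And>a. a \<in> F \<Longrightarrow> d a \<in> F" and trans: "transcendental_over F t"
    and W: "W \<in> polys_over F" "d t = poly W t"
    and P: "irreducible_over F P" "\<not> P dvd pder d W P" and x: "x \<in> F" "d x = 1"
  shows "differential_valuation_ring d F (local_fracs F P t) (fracs F t) (poly P t) x"
proof -
  let ?R = "local_fracs F P t"
  have PF: "P \<in> polys_over F" and degP: "0 < degree P" using P by (auto simp: irreducible_over_def)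
  have P0: "P \<noteq> 0" using degP by force
  then have P1: "\<not> P dvd 1" using degP is_unit_iff_degree[of P] by simp
  have nz: "poly A t \<noteq> 0" if "A \<in> polys_over F" "A \<noteq> 0" for A
    using trans that by (auto simp: transcendental_over_def)
  have nz': "poly A t \<noteq> 0" if "A \<in> polys_over F" "\<not> P dvd A" for A
    using nz that by fastforce
  have prime: "\<not> P dvd A * B" if "A \<in> polys_over F" "\<not> P dvd A" "\<not> P dvd B" for A B
    using irreducible_over_prime[OF F P(1) that(1)] that by blast
  have Delta: "d (poly A t) = poly (pder d W A) t" for A
    by (rule derivation_poly_pder[OF d W(2)])
  have DeltaF: "pder d W A \<in> polys_over F" if "A \<in> polys_over F" for A
    by (rule polys_over_pder[OF F d Fd W(1) that])
  note one = polys_over_1[OF F]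
  have poly_R: "poly A t \<in> ?R" if "A \<in> polys_over F" for A
    by (rule local_fracsI[OF that one P1]) simp
  have inverse_R: "inverse (poly B t) \<in> ?R" if "B \<in> polys_over F" "\<not> P dvd B" for B
    by (rule local_fracsI[OF one that]) (simp add: inverse_eq_divide)
  have FR: "F \<subseteq> ?R"
  proof
    fix a assume "a \<in> F"
    then have "[:a:] \<in> polys_over F" by (simp add: F polys_over_0 polys_over_pCons)
    from poly_R[OF this] show "a \<in> ?R" by simp
  qed
  have RK: "?R \<subseteq> fracs F t"
    using nz' by (auto elim!: local_fracsE intro: fracsI)
  have ring: "a + b \<in> ?R \<and> a * b \<in> ?R" if a: "a \<in> ?R" and b: "b \<in> ?R" for a b
  proof -
    from a obtain A B where A: "A \<in> polys_over F" "B \<in> polys_over F" "\<not> P dvd B"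
      "a = poly A t / poly B t" by (rule local_fracsE)
    from b obtain A' B' where A': "A' \<in> polys_over F" "B' \<in> polys_over F" "\<not> P dvd B'"
      "b = poly A' t / poly B' t" by (rule local_fracsE)
    note B = nz'[OF A(2,3)] nz'[OF A'(2,3)]
    have "a + b \<in> ?R"
      by (rule local_fracsI[of "A * B' + A' * B" _ "B * B'"])
        (use A A' B F prime in \<open>auto intro: polys_over_add polys_over_mult simp: add_frac_eq\<close>)
    moreover have "a * b \<in> ?R"
      by (rule local_fracsI[of "A * A'" _ "B * B'"])
        (use A A' F prime in \<open>auto intro: polys_over_mult\<close>)
    ultimately show ?thesis by blast
  qed
  have Rd: "d a \<in> ?R" if a: "a \<in> ?R" for a
  proof -
    from a obtain A B where A: "A \<in> polys_over F" "B \<in> polys_over F" "\<not> P dvd B"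
      "a = poly A t / poly B t" by (rule local_fracsE)
    show ?thesis
      by (rule local_fracsI[of "pder d W A * B - A * pder d W B" _ "B ^ 2"])
        (use A F irreducible_over_not_dvd_power[OF F P(1)] in
          \<open>auto intro!: polys_over_diff polys_over_mult polys_over_power DeltaF
            simp: derivation_divide[OF d] Delta\<close>)
  qed
  have inv_notin: "inverse (poly P t) \<notin> ?R"
  proof
    assume "inverse (poly P t) \<in> ?R"
    then obtain A B where A: "A \<in> polys_over F" "B \<in> polys_over F" "\<not> P dvd B"
      "inverse (poly P t) = poly A t / poly B t" by (rule local_fracsE)
    moreover have "poly P t \<noteq> 0" "poly B t \<noteq> 0" using nz[OF PF P0] nz'[OF A(2,3)] by auto
    ultimately have "poly (B - P * A) t = 0" by (simp add: field_simps)
    then have "B - P * A = 0"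
      using nz A F PF by (metis polys_over_diff polys_over_mult)
    then show False using A(3) by simp
  qed
  have decomp: "\<exists>n w. w \<in> ?R \<and> inverse w \<in> ?R \<and> w \<noteq> 0 \<and>
      (u = poly P t ^ n * w \<or> u = w / poly P t ^ n)" if u: "u \<in> fracs F t" "u \<noteq> 0" for u
  proof -
    from u(1) obtain A B where A: "A \<in> polys_over F" "B \<in> polys_over F" "poly B t \<noteq> 0"
      "u = poly A t / poly B t" by (rule fracsE)
    have "A \<noteq> 0" "B \<noteq> 0" using A u by auto
    from polys_over_multiplicity[OF F PF degP A(1) this(1)] obtain n A' where
      A': "A = P ^ n * A'" "A' \<in> polys_over F" "\<not> P dvd A'" .
    from polys_over_multiplicity[OF F PF degP A(2) \<open>B \<noteq> 0\<close>] obtain m B' where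
      B': "B = P ^ m * B'" "B' \<in> polys_over F" "\<not> P dvd B'" .
    define w where "w = poly A' t / poly B' t"
    note nz2 = nz'[OF A'(2,3)] nz'[OF B'(2,3)]
    have w: "w \<in> ?R" "inverse w \<in> ?R" "w \<noteq> 0"
      using local_fracsI[OF A'(2) B'(2,3)] local_fracsI[OF B'(2) A'(2,3)] nz2
      by (auto simp: w_def)
    have Pt: "poly P t \<noteq> 0" by (rule nz[OF PF P0])
    have "u = poly P t ^ n * w / poly P t ^ m"
      by (simp add: A(4) A'(1) B'(1) w_def poly_power field_simps)
    \<comment> \<open>Truncated subtraction: whichever of n - m and m - n is the true difference
      selects the disjunct.\<close>
    then have "u = poly P t ^ (n - m) * w \<or> u = w / poly P t ^ (m - n)"
      using Pt by (cases "m \<le> n") (auto simp: power_diff)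
    then show ?thesis using w by blast
  qed
  have "W \<in> polys_over F" by (rule W)
  then have dt: "d t \<in> fracs F t" unfolding W(2) by (rule fracs_poly[OF F])
  have dPt: "poly (pder d W P) t \<noteq> 0" by (rule nz'[OF DeltaF[OF PF] P(2)])
  show ?thesis
  proof
    show "derivation d" "subfield F" "subfield (fracs F t)" "F \<subseteq> ?R" "?R \<subseteq> fracs F t"
      "constants d \<subseteq> F" "x \<in> F" "d x = 1"
      using d F subfield_fracs[OF F] FR RK const x by auto
    show "poly P t \<in> ?R" by (rule poly_R[OF PF])
    show "poly P t \<noteq> 0" by (rule nz[OF PF P0])
    show "inverse (d (poly P t)) \<in> ?R" "d (poly P t) \<noteq> 0"
      unfolding Delta using inverse_R[OF DeltaF[OF PF] P(2)] dPt by auto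
  qed (use char0 inv_notin Rd ring decomp fracs_closed[OF F d Fd dt] in auto)
qed

lemma gen_field_closed:
  fixes d :: "'b::field \<Rightarrow> 'b"
  assumes d: "derivation d" and S: "\<And>a. a \<in> S \<Longrightarrow> d a \<in> gen_field S" and a: "a \<in> gen_field S"
  shows "d a \<in> gen_field S"
proof -
  note G = subfield_gen_field[of S]
  have "d (inverse a) \<in> gen_field S" if "a \<in> gen_field S" "d a \<in> gen_field S" for a
    using that derivation_divide[OF d, of 1 a] by (simp add: inverse_eq_divide derivation_1[OF d])
      (intro subfield_uminus[OF G] subfield_divide[OF G] subfield_power[OF G])
  then have "subfield {a \<in> gen_field S. d a \<in> gen_field S}"
    unfolding subfield_def
    by (auto simp: derivation_0[OF d] derivation_1[OF d] derivation_add[OF d] derivation_mult[OF d]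
      derivation_uminus[OF d] intro: G subfield_intros subfield_inverse)
  moreover have "S \<subseteq> {a \<in> gen_field S. d a \<in> gen_field S}" using S gen_field_superset by blast
  ultimately show ?thesis using gen_field_least a by blast
qed

text \<open>Integration by parts: moving one derivative off g lowers both the power of x and the
  order i by one, so i must vary in the induction and j < i derivatives are enough.\<close>

lemma power_times_iterated_derivative:
  fixes d :: "'b::field \<Rightarrow> 'b"
  assumes d: "derivation d" and M: "subfield M" "\<And>a. a \<in> M \<Longrightarrow> d a \<in> M"
    and x: "x \<in> M" "d x = 1" and g: "g \<in> M" and "j < i"
  shows "\<exists>h\<in>M. x ^ j * (d ^^ i) g = d h"
  using \<open>j < i\<close>
proof (induction j arbitrary: i)
  case (0)
  then obtain k where "i = Suc k" by (cases i) auto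
  moreover have "(d ^^ k) g \<in> M" using g M by (induction k) auto
  ultimately show ?case by (intro bexI[of _ "(d ^^ k) g"]) auto
next
  case (Suc j)
  then obtain k where k: "i = Suc k" "j < k" by (cases i) auto
  then obtain h where h: "h \<in> M" "x ^ j * (d ^^ k) g = d h" using Suc.IH by blast
  have gk: "(d ^^ k) g \<in> M" using g M by (induction k) auto
  have c: "of_nat (Suc j) \<in> constants d" by (rule constants_of_nat[OF d])
  have "d (x ^ Suc j) = of_nat (Suc j) * x ^ j" using derivation_power_Suc[OF d, of x j] x by simp
  then have "d (x ^ Suc j * (d ^^ k) g - of_nat (Suc j) * h) = x ^ Suc j * (d ^^ i) g"
    unfolding derivation_diff[OF d] derivation_mult[OF d, of "x ^ Suc j"] derivation_cmult[OF d c]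
      h(2)[symmetric] k by (simp add: algebra_simps)
  moreover have "x ^ Suc j * (d ^^ k) g - of_nat (Suc j) * h \<in> M"
    by (intro subfield_diff subfield_mult subfield_power subfield_of_nat M x gk h)
  ultimately show ?case by metis
qed

section \<open>The monomial extension\<close>

lemma pemb_0: "pemb 0 = 0"
  by (simp add: pemb_def Zero_fract_def)

lemma pemb_1: "pemb 1 = 1"
  by (simp add: pemb_def One_fract_def)

lemma pemb_add: "pemb (a + b) = pemb a + pemb b"
  by (simp add: pemb_def)

lemma pemb_mult: "pemb (a * b) = pemb a * pemb b"
  by (simp add: pemb_def)

lemma pemb_power: "pemb (a ^ n) = pemb a ^ n"
  by (induction n) (simp_all add: pemb_1 pemb_mult)

lemma pemb_diff: "pemb (a - b) = pemb a - pemb b"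
  by (simp add: pemb_def)

lemma pemb_eq_iff: "pemb a = pemb b \<longleftrightarrow> a = b"
  by (simp add: pemb_def eq_fract)

lemma pemb_eq_0_iff: "pemb a = 0 \<longleftrightarrow> a = 0"
  using pemb_eq_iff[of a 0] by (simp add: pemb_0)

lemma pemb_of_nat: "pemb (of_nat n) = of_nat n"
  by (induction n) (simp_all add: pemb_0 pemb_1 pemb_add)

lemma Fract_pemb: "b \<noteq> 0 \<Longrightarrow> Fract a b = pemb a / pemb b"
  by (simp add: pemb_def)

lemma cemb_add: "cemb (a + b) = cemb a + cemb b"
  unfolding cemb_def pemb_add[symmetric] by simp

lemma cemb_mult: "cemb (a * b) = cemb a * cemb b"
  unfolding cemb_def pemb_mult[symmetric] by (simp add: mult.commute)

lemma cemb_1: "cemb 1 = 1"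
  by (simp add: cemb_def pemb_1 flip: one_pCons)

lemma pemb_pCons: "pemb (pCons a p) = cemb a + tvar * pemb p"
  unfolding cemb_def tvar_def by (simp flip: pemb_add pemb_mult)

locale field_embedding =
  fixes h :: "'c::field \<Rightarrow> 'b::field"
  assumes add: "h (a + b) = h a + h b" and mult: "h (a * b) = h a * h b" and one: "h 1 = 1"
begin

lemma zero: "h 0 = 0"
proof -
  have "h 0 + h 0 = h 0 + 0" using add[of 0 0] by (simp only: add_0_right)
  then show ?thesis by (simp only: add_left_cancel)
qed

lemma uminus: "h (- a) = - h a"
  using add[of a "- a"] by (simp add: zero eq_neg_iff_add_eq_0 add.commute)

lemma eq_0_iff: "h a = 0 \<longleftrightarrow> a = 0"
proof
  assume 0: "h a = 0"
  show "a = 0"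
  proof (rule ccontr)
    assume "a \<noteq> 0"
    then have "h a * h (inverse a) = 1" using mult[of a "inverse a"] by (simp add: one)
    then show False using 0 by simp
  qed
qed (simp add: zero)

lemma inverse: "h (inverse a) = inverse (h a)"
proof (cases "a = 0")
  case False
  then have "h a * h (inverse a) = 1" using mult[of a "inverse a"] by (simp add: one)
  then show ?thesis using inverse_unique by metis
qed (simp add: zero)

lemma divide: "h (a / b) = h a / h b"
  by (simp add: divide_inverse mult inverse)

lemma of_nat: "h (of_nat n) = of_nat n"
  by (induction n) (simp_all add: zero one add)

lemma subfield_range: "subfield (range h)"
  unfolding subfield_def
proof (intro conjI ballI)
  show "0 \<in> range h" "1 \<in> range h" using zero one by (metis rangeI)+
  fix x assume "x \<in> range h"
  then obtain a where a: "x = h a" by blast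
  show "- x \<in> range h" "inverse x \<in> range h"
    unfolding a uminus[symmetric] inverse[symmetric] by (rule rangeI)+
  fix y assume "y \<in> range h"
  then obtain b where b: "y = h b" by blast
  show "x + y \<in> range h" "x * y \<in> range h"
    unfolding a b add[symmetric] mult[symmetric] by (rule rangeI)+
qed

end

locale monomial_extension =
  fixes D :: "'a::field_char_0 \<Rightarrow> 'a" and Dt :: "'a poly fract \<Rightarrow> 'a poly fract" and w :: "'a poly"
  assumes D: "derivation D" and Dt: "derivation Dt" and Dt_cemb: "\<And>a. Dt (cemb a) = cemb (D a)"
    and Dt_tvar: "Dt tvar = pemb w"
begin

abbreviation "Delta \<equiv> pder D w"

text \<open>Thus \<open>Dt\<close> maps F[t] into itself, and being special becomes a divisibility
  statement about \<open>Delta\<close>.\<close>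

lemma Dt_pemb: "Dt (pemb p) = pemb (Delta p)"
proof (induction p)
  case 0
  then show ?case by (simp add: pemb_0 derivation_0[OF Dt] pder_def)
next
  case (pCons a p)
  have "Delta (pCons a p) = [:D a:] + (w * p + [:0, 1:] * Delta p)"
    by (simp add: pder_def map_poly_pCons derivation_0[OF D] pderiv_pCons algebra_simps)
  moreover have "Dt (pemb (pCons a p)) = cemb (D a) + (pemb w * pemb p + tvar * pemb (Delta p))"
    by (simp add: pemb_pCons derivation_add[OF Dt] derivation_mult[OF Dt] Dt_cemb Dt_tvar pCons.IH)
  ultimately show ?case by (simp only: pemb_add pemb_mult cemb_def tvar_def)
qed

lemma special_iff: "special Dt p \<longleftrightarrow> p dvd Delta p"
  unfolding special_def Dt_pemb by (auto simp: pemb_eq_iff)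

text \<open>Hermite reduction inside F(t): subtracting a derivative lowers the power of a normal
  prime in the denominator and leaves the cofactor e unchanged, so the degree of the denominator
  drops.\<close>

lemma hermite_step:
  assumes p: "irreducible_over UNIV p" "\<not> p dvd Delta p" and e: "\<not> p dvd e" and k: "0 < k"
  obtains B a' where "Fract a (p ^ Suc k * e) - Dt (pemb B / pemb p ^ k) = Fract a' (p ^ k * e)"
proof -
  obtain U V where UV: "U * p + V * Delta p = 1"
    using irreducible_over_bezout[OF subfield_UNIV p(1) _ p(2)] by (auto simp: polys_over_UNIV)
  obtain U' V' where UV': "U' * p + V' * e = 1"
    using irreducible_over_bezout[OF subfield_UNIV p(1) _ e] by (auto simp: polys_over_UNIV)
  \<comment> \<open>V inverts \<open>Delta p\<close> and V' inverts e modulo p, so \<open>B\<close>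
    solves a + k B (Delta p) e = 0 modulo p.\<close>
  define B where "B = [:- inverse (of_nat k):] * (a * V * V')"
  \<comment> \<open>The new numerator divided by p: a - a (1 - U p)(1 - U' p) equals p times a (U +
    U' - U U' p).\<close>
  define a' where "a' = a * (U + U' - U * U' * p) - Delta B * e"
  have "of_nat k * B = [:of_nat k:] * B" by (simp add: of_nat_poly)
  also have "\<dots> = ([:of_nat k:] * [:- inverse (of_nat k):]) * (a * V * V')"
    by (simp only: B_def mult.assoc)
  also have "[:of_nat k:] * [:- inverse (of_nat k):] = (- 1 :: 'a poly)"
    using k by (simp add: one_pCons)
  finally have kB: "of_nat k * B = - (a * V * V')" by simp
  have "of_nat k * B * Delta p * e = - (a * (V * Delta p) * (V' * e))"
    unfolding kB by (simp add: algebra_simps)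
  also have "\<dots> = - (a * (1 - U * p) * (1 - U' * p))"
  proof -
    have "V * Delta p = 1 - U * p" "V' * e = 1 - U' * p" using UV UV' by (metis add_diff_cancel_left')+
    then show ?thesis by simp
  qed
  finally have "of_nat k * B * Delta p * e = - (a * (1 - U * p) * (1 - U' * p))" .
  then have num: "a - e * (p * Delta B - of_nat k * B * Delta p) = p * a'"
    by (simp add: a'_def algebra_simps)
  have p0: "p \<noteq> 0" "e \<noteq> 0" using p e by (auto simp: irreducible_over_def)
  define \<pi> \<epsilon> where "\<pi> = pemb p" and "\<epsilon> = pemb e"
  have nz: "\<pi> \<noteq> 0" "\<epsilon> \<noteq> 0" using p0 by (auto simp: \<pi>_def \<epsilon>_def pemb_eq_0_iff)
  define h where "h = Fract a (p ^ Suc k * e)"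
  have "\<pi> ^ Suc k * \<epsilon> * h = pemb a"
    using p0 nz by (simp add: h_def Fract_pemb pemb_mult pemb_power \<pi>_def \<epsilon>_def)
  moreover have "\<pi> ^ Suc k * Dt (pemb B / \<pi> ^ k) = pemb (p * Delta B - of_nat k * B * Delta p)"
    unfolding derivation_div_power[OF Dt nz(1)]
    by (simp add: \<pi>_def Dt_pemb pemb_mult pemb_diff pemb_of_nat)
  moreover have "\<pi> ^ Suc k * \<epsilon> * (h - Dt (pemb B / \<pi> ^ k))
      = \<pi> ^ Suc k * \<epsilon> * h - \<epsilon> * (\<pi> ^ Suc k * Dt (pemb B / \<pi> ^ k))"
    by (simp only: right_diff_distrib ac_simps)
  ultimately have "\<pi> ^ Suc k * \<epsilon> * (h - Dt (pemb B / \<pi> ^ k))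
      = pemb (a - e * (p * Delta B - of_nat k * B * Delta p))"
    by (simp only: \<epsilon>_def pemb_diff[of a] pemb_mult[of e])
  then have "\<pi> * (\<pi> ^ k * \<epsilon> * (h - Dt (pemb B / \<pi> ^ k))) = \<pi> * pemb a'"
    unfolding num by (simp add: pemb_mult \<pi>_def mult.assoc)
  then have "\<pi> ^ k * \<epsilon> * (h - Dt (pemb B / \<pi> ^ k)) = pemb a'" using nz by simp
  then have "h - Dt (pemb B / \<pi> ^ k) = pemb a' / (\<pi> ^ k * \<epsilon>)"
    using nz by (simp add: eq_divide_eq mult.commute)
  also have "\<dots> = Fract a' (p ^ k * e)"
    using p0 by (simp add: Fract_pemb pemb_mult pemb_power \<pi>_def \<epsilon>_def)
  finally show thesis using that unfolding h_def \<pi>_def by blast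
qed

text \<open>If p and c both divide their derivatives, so does p c. Splitting off special prime
  factors of b must therefore end in a normal one.\<close>

lemma normal_factor_ex:
  assumes "b \<noteq> 0" "\<not> b dvd Delta b"
  shows "\<exists>p. irreducible_over UNIV p \<and> p dvd b \<and> \<not> p dvd Delta p"
  using assms
proof (induction "degree b" arbitrary: b rule: less_induct)
  case less
  have "degree b \<noteq> 0"
    using less.prems is_unit_iff_degree[of b] unit_imp_dvd by blast
  then obtain p where p: "irreducible_over UNIV p" "p dvd b"
    using irreducible_over_ex[OF subfield_UNIV, of b] by (auto simp: polys_over_UNIV)
  show ?case
  proof (cases "p dvd Delta p")
    case True
    from p obtain c where c: "b = p * c" by (auto elim: dvdE)
    have "Delta b = Delta p * c + p * Delta c" unfolding c by (rule pder_mult[OF D])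
    then have "\<not> c dvd Delta c"
      using less.prems(2) True unfolding c by (auto intro!: dvd_add mult_dvd_mono)
    moreover have "degree c < degree b" "c \<noteq> 0"
      using p less.prems by (auto simp: c degree_mult_eq irreducible_over_def)
    ultimately obtain q where "irreducible_over UNIV q" "q dvd c" "\<not> q dvd Delta q"
      using less.hyps by blast
    then show ?thesis using c by auto
  qed (use p in blast)
qed

end

section \<open>Transfer of the monomial extension into the ambient field\<close>

locale monomial_embedding = monomial_extension D Dt w
  for D :: "'a::field_char_0 \<Rightarrow> 'a" and Dt w +
  fixes d :: "'b::field \<Rightarrow> 'b" and \<iota> :: "'a poly fract \<Rightarrow> 'b"
  assumes d: "derivation d" and emb: "diff_embedding Dt d \<iota>"
    and const: "constants Dt = cemb ` constants D"
begin

sublocale iota: field_embedding \<iota>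
  using emb by unfold_locales (auto simp: diff_embedding_def)

lemma iota_deriv: "d (\<iota> a) = \<iota> (Dt a)"
  using emb by (auto simp: diff_embedding_def)

lemma char0: "0 < n \<Longrightarrow> of_nat n \<noteq> (0::'b)"
proof -
  assume n: "0 < n"
  have "of_nat n = (pemb (of_nat n) :: 'a poly fract)" by (simp add: pemb_of_nat)
  then have "of_nat n \<noteq> (0 :: 'a poly fract)" using n by (simp add: pemb_eq_0_iff)
  then show ?thesis using iota.of_nat[of n] iota.eq_0_iff[of "of_nat n"] by simp
qed

definition j :: "'a \<Rightarrow> 'b" where
  "j a = \<iota> (cemb a)"

definition \<tau> :: 'b where
  "\<tau> = \<iota> tvar"

definition \<Phi> :: "'a poly \<Rightarrow> 'b poly" where
  "\<Phi> p = map_poly j p"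

sublocale j: field_embedding j
  by unfold_locales (simp_all add: j_def cemb_add cemb_mult cemb_1 iota.add iota.mult iota.one)

lemma Phi_polys_over: "\<Phi> p \<in> polys_over (range j)"
  by (simp add: polys_over_def \<Phi>_def coeff_map_poly j.zero)

lemma degree_Phi: "degree (\<Phi> p) = degree p"
  unfolding \<Phi>_def by (rule degree_map_poly) (simp add: j.eq_0_iff)

lemma poly_Phi: "poly (\<Phi> p) \<tau> = \<iota> (pemb p)"
proof (induction p)
  case 0
  then show ?case by (simp add: \<Phi>_def pemb_0 iota.zero)
next
  case (pCons a p)
  then show ?case
    unfolding \<Phi>_def map_poly_pCons[of j, OF j.zero]
    by (simp add: pemb_pCons iota.add iota.mult j_def \<tau>_def)
qed

lemma Phi_surj: "Q \<in> polys_over (range j) \<Longrightarrow> \<exists>q. Q = \<Phi> q"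
proof (induction Q)
  case 0
  then show ?case by (intro exI[of _ 0]) (simp add: \<Phi>_def)
next
  case (pCons a Q)
  have "coeff Q i \<in> range j" for i using polys_over_coeff[OF pCons.prems, of "Suc i"] by simp
  then obtain q where "Q = \<Phi> q" using pCons.IH by (auto simp: polys_over_def)
  moreover obtain b where "a = j b" using polys_over_coeff[OF pCons.prems, of 0] by auto
  ultimately show ?case by (intro exI[of _ "pCons b q"]) (simp add: \<Phi>_def map_poly_pCons j.zero)
qed

lemma transcendental_tau: "transcendental_over (range j) \<tau>"
  unfolding transcendental_over_def
proof (intro ballI impI)
  fix Q assume "Q \<in> polys_over (range j)" and 0: "poly Q \<tau> = 0"
  then obtain q where q: "Q = \<Phi> q" using Phi_surj by blast
  then show "Q = 0" using 0 by (simp add: poly_Phi iota.eq_0_iff pemb_eq_0_iff) (simp add: \<Phi>_def)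
qed

text \<open>Identities between polynomials over the image of F may be checked at the image of t;
  this yields the homomorphism properties of \<open>\<Phi>\<close> and its compatibility with
  \<open>Delta\<close>.\<close>

lemma eq_if_value_eq:
  assumes "A \<in> polys_over (range j)" "B \<in> polys_over (range j)" "poly A \<tau> = poly B \<tau>"
  shows "A = B"
proof -
  have "A - B \<in> polys_over (range j)" by (intro polys_over_diff j.subfield_range assms)
  then have "A - B = 0" using transcendental_tau assms(3) by (auto simp: transcendental_over_def)
  then show ?thesis by simp
qed

lemma Phi_mult: "\<Phi> (p * q) = \<Phi> p * \<Phi> q"
  by (rule eq_if_value_eq)
    (simp_all add: Phi_polys_over polys_over_mult j.subfield_range poly_Phi pemb_mult iota.mult)

lemma Phi_add: "\<Phi> (p + q) = \<Phi> p + \<Phi> q"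
  by (rule eq_if_value_eq)
    (simp_all add: Phi_polys_over polys_over_add j.subfield_range poly_Phi pemb_add iota.add)

lemma Phi_1: "\<Phi> 1 = 1"
  by (simp add: \<Phi>_def j.one)

lemma d_j: "d (j a) = j (D a)"
  by (simp add: j_def iota_deriv Dt_cemb)

lemma d_tau: "d \<tau> = poly (\<Phi> w) \<tau>"
  unfolding poly_Phi by (simp add: \<tau>_def iota_deriv Dt_tvar)

lemma Phi_Delta: "\<Phi> (Delta p) = pder d (\<Phi> w) (\<Phi> p)"
proof (rule eq_if_value_eq)
  show "pder d (\<Phi> w) (\<Phi> p) \<in> polys_over (range j)"
    by (intro polys_over_pder j.subfield_range d Phi_polys_over) (auto simp: d_j)
  show "poly (\<Phi> (Delta p)) \<tau> = poly (pder d (\<Phi> w) (\<Phi> p)) \<tau>"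
    unfolding derivation_poly_pder[OF d d_tau, symmetric] by (simp add: poly_Phi iota_deriv Dt_pemb)
qed (rule Phi_polys_over)

abbreviation "F \<equiv> gen_field (range j \<union> constants d)"

lemma F: "subfield F"
  by (rule subfield_gen_field)

lemma const_F: "constants d \<subseteq> F"
  by (rule order.trans[OF _ gen_field_superset]) simp

lemma j_F: "j a \<in> F"
  by (rule subsetD[OF gen_field_superset]) simp

lemma Phi_F: "\<Phi> p \<in> polys_over F"
proof -
  have "range j \<subseteq> F" using j_F by auto
  from subsetD[OF polys_over_mono[OF this] Phi_polys_over] show ?thesis .
qed

lemma F_closed: "a \<in> F \<Longrightarrow> d a \<in> F"
proof (rule gen_field_closed[OF d])
  fix a assume "a \<in> range j \<union> constants d"
  then consider b where "a = j b" | "d a = 0" by (auto simp: constants_def)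
  then show "d a \<in> F" by cases (simp_all add: d_j j_F subfield_0[OF F])
qed

text \<open>The hypothesis that F(t) has no constants outside F is what makes the constants of the
  image of F(t) lie in the image of F.\<close>

lemma transcendental_F: "transcendental_over F \<tau>"
proof -
  have "range \<iota> \<inter> constants d \<subseteq> range j"
  proof
    fix y assume "y \<in> range \<iota> \<inter> constants d"
    then obtain z where z: "y = \<iota> z" "d (\<iota> z) = 0" by (auto simp: constants_def)
    then have "z \<in> constants Dt" by (simp add: iota_deriv iota.eq_0_iff constants_def)
    then show "y \<in> range j" using z const by (auto simp: j_def)
  qed
  then interpret constant_extension d "range j" "range \<iota>" \<tau>
  proof unfold_locales
    show "range j \<subseteq> range \<iota>" "\<tau> \<in> range \<iota>" by (auto simp: j_def \<tau>_def)
  qed (use d j.subfield_range iota.subfield_range transcendental_tau iota_deriv in auto)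
  show ?thesis by (rule transcendental_constant_extension)
qed

lemma iota_fracs: "\<iota> a \<in> fracs F \<tau>"
proof (cases a)
  case (Fract p q)
  then show ?thesis
    by (intro fracsI[OF Phi_F[of p] Phi_F[of q]])
      (simp_all add: poly_Phi Fract_pemb iota.divide iota.eq_0_iff pemb_eq_0_iff)
qed

text \<open>A simple pole of a representative of f at a normal prime p would persist at a prime
  factor P of p over F(C), where \<open>simple_part_vanishes\<close> rules it out.\<close>

lemma simple_normal_pole_False:
  assumes p: "irreducible_over UNIV p" "\<not> p dvd Delta p" and e: "\<not> p dvd e" and a: "\<not> p dvd a"
    and f: "f = Dt g + Fract a (p * e)" "f = Fract a0 b0" "b0 \<noteq> 0" and x: "D x = 1"
    and E: "elementary_ext d (range \<iota>) E" and G: "G \<in> E" "\<iota> f = (d ^^ Suc (degree b0)) G"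
  shows False
proof -
  have p0: "p \<noteq> 0" "e \<noteq> 0" using p e by (auto simp: irreducible_over_def)
  \<comment> \<open>Bezout relations survive the passage to F(C), although p may become reducible
    there; P thus inherits normality and the non-divisibilities from p.\<close>
  have coprime: "\<exists>U V. \<Phi> U * \<Phi> p + \<Phi> V * \<Phi> q = 1" if "\<not> p dvd q" for q
  proof -
    from irreducible_over_bezout[OF subfield_UNIV p(1) _ that] obtain U V where "U * p + V * q = 1"
      by (auto simp: polys_over_UNIV)
    then have "\<Phi> (U * p + V * q) = 1" by (simp add: Phi_1)
    then show ?thesis unfolding Phi_add Phi_mult by blast
  qed
  have "degree (\<Phi> p) > 0" using p by (simp add: degree_Phi irreducible_over_def)
  then obtain P where P: "irreducible_over F P" "P dvd \<Phi> p"
    using irreducible_over_ex[OF F Phi_F] by blast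
  have PF: "P \<in> polys_over F" and degP: "0 < degree P" using P by (auto simp: irreducible_over_def)
  moreover from degP have "P \<noteq> 0" by force
  ultimately have P1: "\<not> P dvd 1" using is_unit_iff_degree[of P] by simp
  have not_dvd: "\<not> P dvd \<Phi> q" if "\<not> p dvd q" for q
  proof
    assume "P dvd \<Phi> q"
    moreover obtain U V where "\<Phi> U * \<Phi> p + \<Phi> V * \<Phi> q = 1" using coprime[OF \<open>\<not> p dvd q\<close>] by blast
    ultimately show False using P(2) P1 by (metis dvd_add dvd_mult)
  qed
  obtain Q where Q: "Q \<in> polys_over F" "\<Phi> p = P * Q"
    using polys_over_dvdE[OF F PF Phi_F P(2)] by blast
  have "\<Phi> (Delta p) = pder d (\<Phi> w) P * Q + P * pder d (\<Phi> w) Q"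
    unfolding Phi_Delta Q(2) by (rule pder_mult[OF d])
  \<comment> \<open>If P divided its own derivative, or divided Q, it would divide the image of
    \<open>Delta p\<close>.\<close>
  then have normal: "\<not> P dvd pder d (\<Phi> w) P" and PQ: "\<not> P dvd Q"
    using not_dvd[OF p(2)] by auto
  interpret V: differential_valuation_ring d F "local_fracs F P \<tau>" "fracs F \<tau>" "poly P \<tau>" "j x"
    by (rule differential_valuation_ring_local_fracs[OF char0 d F const_F F_closed transcendental_F
        Phi_F d_tau P(1) normal]) (auto simp: j_F d_j x j.one)
  have prime: "\<not> P dvd A * B" if "A \<in> polys_over F" "\<not> P dvd A" "\<not> P dvd B" for A B
    using irreducible_over_prime[OF F P(1) that(1)] that by blast
  have nz: "poly A \<tau> \<noteq> 0" if "A \<in> polys_over F" "\<not> P dvd A" for A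
    using transcendental_F that by (auto simp: transcendental_over_def)
  define h where "h = \<iota> (Fract a (p * e))"
  have h: "h = poly (\<Phi> a) \<tau> / (poly P \<tau> * poly (Q * \<Phi> e) \<tau>)"
    using p0 by (simp add: h_def Fract_pemb pemb_mult iota.divide iota.mult mult.assoc
      flip: poly_Phi) (simp add: Q(2) mult.assoc)
  have QF: "Q * \<Phi> e \<in> polys_over F" and PQe: "\<not> P dvd Q * \<Phi> e"
    by (auto intro: polys_over_mult F Q Phi_F simp: prime[OF Q(1) PQ not_dvd[OF e]])
  have ph: "poly P \<tau> * h \<in> local_fracs F P \<tau>"
    by (rule local_fracsI[OF Phi_F[of a] QF PQe]) (simp add: h V.p(2))
  have "\<Phi> b0 \<noteq> 0"
    using f(3) poly_Phi[of b0] by (auto simp: iota.eq_0_iff pemb_eq_0_iff)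
  \<comment> \<open>m bounds the pole order of f at P. It is at most \<open>degree b0\<close>, which
    does not depend on d, so the i-th antiderivative for i = degree b0 + 1 serves every power x^j
    with j at most m.\<close>
  from polys_over_multiplicity[OF F PF degP Phi_F this] obtain m B where
    B: "\<Phi> b0 = P ^ m * B" "B \<in> polys_over F" "\<not> P dvd B" by blast
  have "B \<noteq> 0" "P \<noteq> 0" using B degP by auto
  then have "degree b0 = m * degree P + degree B"
    using arg_cong[OF B(1), of degree] by (simp add: degree_Phi degree_mult_eq degree_power_eq)
  moreover have "m \<le> m * degree P" using degP by simp
  ultimately have m: "m \<le> degree b0" by linarith
  have "\<iota> f = poly (\<Phi> a0) \<tau> / (poly P \<tau> ^ m * poly B \<tau>)"
    using f(3) by (simp add: f(2) Fract_pemb iota.divide flip: poly_Phi) (simp add: B(1))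
  then have pf: "poly P \<tau> ^ m * \<iota> f \<in> local_fracs F P \<tau>"
    by (intro local_fracsI[OF Phi_F[of a0] B(2,3)]) (simp add: V.p(2))
  have K: "subfield (fracs F \<tau>)" by (rule V.K)
  obtain M where M: "subfield M" "\<And>a. a \<in> M \<Longrightarrow> d a \<in> M" "fracs F \<tau> \<subseteq> M" "E \<subseteq> M"
    "\<And>h. h \<in> fracs F \<tau> \<Longrightarrow> h \<in> liouville_forms d M \<Longrightarrow> h \<in> liouville_forms d (fracs F \<tau>)"
  proof (rule liouville[OF char0 d K _ V.Kd _ E])
    show "constants d \<subseteq> fracs F \<tau>" using const_F fracs_superset[OF F] by blast
    show "range \<iota> \<subseteq> fracs F \<tau>" using iota_fracs by blast
  qed auto
  have jx: "j x \<in> fracs F \<tau>" using fracs_superset[OF F] j_F by blast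
  have lf: "j x ^ i * \<iota> f \<in> liouville_forms d (fracs F \<tau>)" if "i \<le> m" for i
  proof (rule M(5))
    show "j x ^ i * \<iota> f \<in> fracs F \<tau>"
      by (intro subfield_mult[OF K] subfield_power[OF K] jx iota_fracs)
    have "i < Suc (degree b0)" using that m by simp
    moreover have "j x \<in> M" "d (j x) = 1" "G \<in> M" using jx M(3,4) G(1) x by (auto simp: d_j j.one)
    ultimately obtain H where "H \<in> M" "j x ^ i * (d ^^ Suc (degree b0)) G = d H"
      using power_times_iterated_derivative[OF d M(1,2)] by blast
    then have "H \<in> M" "j x ^ i * \<iota> f = d H + 0" by (simp_all add: G(2))
    then show "j x ^ i * \<iota> f \<in> liouville_forms d M"
      using log_forms_0 unfolding liouville_forms_def by blast
  qed
  have "h \<in> local_fracs F P \<tau>"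
    by (rule V.simple_part_vanishes[OF iota_fracs pf lf iota_fracs[of g] ph])
      (simp_all add: f(1) h_def iota.add iota_deriv)
  then obtain A C where A: "A \<in> polys_over F" "C \<in> polys_over F" "\<not> P dvd C"
    "h = poly A \<tau> / poly C \<tau>" by (rule local_fracsE)
  \<comment> \<open>Cross-multiplying the two expressions for h makes P divide the image of a times
    C, while it divides neither.\<close>
  have "poly (\<Phi> a * C - P * (A * (Q * \<Phi> e))) \<tau> = 0"
    using A(4) nz[OF A(2,3)] nz[OF QF PQe] V.p(2) unfolding h by (simp add: field_simps)
  moreover have "\<Phi> a * C - P * (A * (Q * \<Phi> e)) \<in> polys_over F"
    by (intro polys_over_diff polys_over_mult F Phi_F A PF Q)
  ultimately have "\<Phi> a * C = P * (A * (Q * \<Phi> e))"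
    using transcendental_F by (auto simp: transcendental_over_def)
  then show False using prime[OF Phi_F not_dvd[OF a] A(3)] by (metis dvd_triv_left)
qed

end

theorem theorem3p5:
  fixes D :: "'a::field_char_0 \<Rightarrow> 'a"
    and Dt :: "'a poly fract \<Rightarrow> 'a poly fract"
    and x :: 'a
    and f :: "'a poly fract"
  assumes "derivation D"
    and "D x = 1"
    and "alg_closed_in (constants D)"
    and "monomial_ext D Dt"
    and "constants Dt = cemb ` constants D"
    and "stable_elem Dt f TYPE('b::field)"
  shows "\<exists>g. reduced Dt (f - Dt g)"
proof -
  from assms(4) obtain w where w: "derivation Dt" "\<And>a. Dt (cemb a) = cemb (D a)" "Dt tvar = pemb w"
    by (auto simp: monomial_ext_def)
  interpret monomial_extension D Dt w by unfold_locales (use assms w in auto)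
  obtain a0 b0 where f: "f = Fract a0 b0" "b0 \<noteq> 0" by (cases f) auto
  \<comment> \<open>The denominators, not necessarily in lowest terms, of representatives of f
    modulo derivatives.\<close>
  define S where "S b \<longleftrightarrow> b \<noteq> 0 \<and> (\<exists>g a. f - Dt g = Fract a b)" for b
  have "S b0" unfolding S_def using f by (intro conjI exI[of _ 0] exI[of _ a0]) (auto simp: derivation_0[OF Dt])
  then obtain b where "S b" and min: "\<And>c. S c \<Longrightarrow> degree b \<le> degree c"
    using arg_min_nat_lemma[of S b0 degree] by blast
  then obtain g a where b: "b \<noteq> 0" "f - Dt g = Fract a b" unfolding S_def by blast
  \<comment> \<open>Cancelling a common factor gives another member of \<open>S\<close>, so
    minimality forces lowest terms.\<close>
  have cop: "is_unit c" if c: "c dvd a" "c dvd b" for c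
  proof -
    from c obtain a' b' where ab: "a = c * a'" "b = c * b'" by (auto elim!: dvdE)
    then have nz: "c \<noteq> 0" "b' \<noteq> 0" using b by auto
    have "Fract a b = Fract a' b'" using nz by (simp add: ab Fract_pemb pemb_mult pemb_eq_0_iff)
    then have "S b'" unfolding S_def using nz b by metis
    then have "degree c = 0" using min[of b'] nz by (simp add: ab degree_mult_eq)
    then show ?thesis using is_unit_iff_degree[OF nz(1)] by simp
  qed
  have "b dvd Delta b"
  proof (rule ccontr)
    assume "\<not> b dvd Delta b"
    then obtain p where p: "irreducible_over UNIV p" "p dvd b" "\<not> p dvd Delta p"
      using normal_factor_ex b(1) by blast
    have degp: "0 < degree p" using p by (simp add: irreducible_over_def)
    from polys_over_multiplicity[OF subfield_UNIV _ degp _ b(1)] obtain n e where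
      e: "b = p ^ n * e" "\<not> p dvd e" by (auto simp: polys_over_UNIV)
    have "n \<noteq> 0" using e p(2) by (cases n) auto
    \<comment> \<open>A simple normal pole contradicts stability; a multiple one contradicts
      minimality by a Hermite step.\<close>
    then consider "n = 1" | k where "0 < k" "n = Suc k" by (cases n) auto
    then show False
    proof cases
      case 1
      have "p \<noteq> 0" using degp by force
      then have "\<not> p dvd a" using cop[OF _ p(2)] degp is_unit_iff_degree[of p] by linarith
      moreover have fg: "f = Dt g + Fract a (p * e)" using b(2) e(1) 1 by (simp add: algebra_simps)
      moreover from assms(6) obtain G where "\<And>i. \<exists>(DE::'b \<Rightarrow> 'b) \<iota> E. derivation DE \<and>
          diff_embedding Dt DE \<iota> \<and> elementary_ext DE (range \<iota>) E \<and> G i \<in> E \<and> \<iota> f = (DE ^^ i) (G i)"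
        unfolding stable_elem_def by blast
      then obtain d :: "'b \<Rightarrow> 'b" and \<iota> E where ext: "derivation d" "diff_embedding Dt d \<iota>"
        "elementary_ext d (range \<iota>) E" "G (Suc (degree b0)) \<in> E"
        "\<iota> f = (d ^^ Suc (degree b0)) (G (Suc (degree b0)))" by blast
      interpret monomial_embedding D Dt w d \<iota> by unfold_locales (use ext assms in auto)
      show False
        by (rule simple_normal_pole_False[OF p(1,3) e(2) _ fg f assms(2) ext(3-5)]) fact
    next
      case 2
      obtain B a' where "Fract a (p ^ Suc k * e) - Dt (pemb B / pemb p ^ k) = Fract a' (p ^ k * e)"
        using hermite_step[OF p(1,3) e(2) 2(1)] .
      then have "f - Dt (g + pemb B / pemb p ^ k) = Fract a' (p ^ k * e)"
        using b(2) by (simp add: derivation_add[OF Dt] e(1) 2(2) algebra_simps)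
      moreover have nz: "p \<noteq> 0" "e \<noteq> 0" using degp e(2) by force+
      ultimately have "S (p ^ k * e)" unfolding S_def by auto
      then have "degree b \<le> degree (p ^ k * e)" by (rule min)
      then show False using nz degp by (simp add: e(1) 2(2) degree_mult_eq)
    qed
  qed
  moreover have "coprime a b" using cop by (rule coprimeI)
  ultimately show ?thesis
    unfolding reduced_def using b special_iff by blast
qed

end
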